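(* A nilsoliton cannot be of gradient type. That is, if $N$ is a nilpotent Lie group and $g$ is a left invariant Riemannian metric on $N$ which is a Ricci soliton, then there do not exist a smooth function $f : N \to \mathbb{R}$ and a constant $\lambda \in \mathbb{R}$ such that $$\mathrm{Ric}_g + \mathrm{Hess} f = \lambda g .$$
   Context: A Riemannian metric $g$ on a smooth manifold $M$ is a Ricci soliton if there exist a smooth vector field $X$ on $M$ and a constant $\lambda \in \mathbb{R}$ (the soliton constant) such that $\mathrm{Ric}_g + \frac{1}{2}\mathcal{L}_X g = \lambda g$, where $\mathrm{Ric}_g$ is the Ricci tensor of $g$ and $\mathcal{L}_X$ is the Lie derivative along $X$. A gradient Ricci soliton (a soliton of gradient type) is a Riemannian metric $g$ together with a smooth function $f : M \to \mathbb{R}$ such that $\mathrm{Ric}_g + \mathrm{Hess} f = \lambda g$, where $\lambda \in \mathbb{R}$ is the soliton constant and $\mathrm{Hess} f$ is the Hessian of $f$ with respect to the Levi-Civita connection of $g$. A (Ricci) nilsoliton is a left invariant Ricci soliton metric on a nilpotent Lie group.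
   Formalization: The Lie algebra of N is additionally assumed non-abelian: if it is abelian, every left invariant metric on N is flat, and f = 0, λ = 0 satisfies Ric_g + Hess f = λg, so the claim as stated fails. *)

theory Defs
  imports "HOL-Analysis.Analysis" "HOL-Algebra.Generated_Groups"
begin

section \<open>Smooth maps between open subsets of normed spaces\<close>

abbreviation dir_deriv ::
    "('a::real_normed_vector \<Rightarrow> 'b::real_normed_vector) \<Rightarrow> 'a \<Rightarrow> 'a \<Rightarrow> 'b"
  where "dir_deriv F x u \<equiv> frechet_derivative F (at x) u"

text \<open>Only used for open \<open>S\<close> in finite-dimensional spaces, where existence and continuity of all
  iterated directional derivatives up to order \<open>k\<close> is the usual notion of class C^k.\<close>

primrec Ck_on ::
    "nat \<Rightarrow> ('a::real_normed_vector \<Rightarrow> 'b::real_normed_vector) \<Rightarrow> 'a set \<Rightarrow> bool" where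
  "Ck_on 0 F S \<longleftrightarrow> continuous_on S F"
| "Ck_on (Suc k) F S \<longleftrightarrow>
     (\<forall>x\<in>S. F differentiable (at x)) \<and> (\<forall>u. Ck_on k (\<lambda>x. dir_deriv F x u) S)"

definition smooth_on ::
    "('a::real_normed_vector \<Rightarrow> 'b::real_normed_vector) \<Rightarrow> 'a set \<Rightarrow> bool"
  where "smooth_on F S \<longleftrightarrow> (\<forall>k. Ck_on k F S)"

section \<open>Smooth manifolds\<close>

text \<open>A chart is a pair of its domain and the coordinate map; values of the coordinate map outside
  the domain are irrelevant. Atlases are not required to be maximal. The dimension of the manifold
  is the dimension of the model space \<open>'e\<close>.\<close>

type_synonym ('a, 'e) chart = "'a set \<times> ('a \<Rightarrow> 'e)"

abbreviation cimage :: "('a, 'e) chart \<Rightarrow> 'e set"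
  where "cimage c \<equiv> snd c ` fst c"

abbreviation cinv :: "('a, 'e) chart \<Rightarrow> 'e \<Rightarrow> 'a"
  where "cinv c \<equiv> inv_into (fst c) (snd c)"

locale smooth_manifold =
  fixes T :: "'a topology" and A :: "('a, 'e::euclidean_space) chart set"
  assumes Hausdorff: "Hausdorff_space T"
    and second_countable: "second_countable T"
    and chart_open: "c \<in> A \<Longrightarrow> openin T (fst c)"
    and chart_image_open: "c \<in> A \<Longrightarrow> open (cimage c)"
    and chart_homeo: "c \<in> A \<Longrightarrow>
      homeomorphic_map (subtopology T (fst c)) (top_of_set (cimage c)) (snd c)"
    and charts_cover: "(\<Union>c\<in>A. fst c) = topspace T"
    and charts_compatible: "c \<in> A \<Longrightarrow> d \<in> A \<Longrightarrow>
      smooth_on (snd d \<circ> cinv c) (snd c ` (fst c \<inter> fst d))"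

definition smooth_map ::
    "'a topology \<Rightarrow> ('a, 'e::euclidean_space) chart set \<Rightarrow>
     'b topology \<Rightarrow> ('b, 'f::euclidean_space) chart set \<Rightarrow> ('a \<Rightarrow> 'b) \<Rightarrow> bool"
  where "smooth_map T A T' B F \<longleftrightarrow> continuous_map T T' F \<and>
    (\<forall>c\<in>A. \<forall>d\<in>B. smooth_on (snd d \<circ> F \<circ> cinv c) (snd c ` {p \<in> fst c. F p \<in> fst d}))"

definition smooth_function :: "('a, 'e::euclidean_space) chart set \<Rightarrow> ('a \<Rightarrow> real) \<Rightarrow> bool"
  where "smooth_function A f \<longleftrightarrow> (\<forall>c\<in>A. smooth_on (f \<circ> cinv c) (cimage c))"

definition product_atlas ::
    "('a, 'e) chart set \<Rightarrow> ('b, 'f) chart set \<Rightarrow> ('a \<times> 'b, 'e \<times> 'f) chart set"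
  where "product_atlas A B =
    (\<lambda>(c, d). (fst c \<times> fst d, \<lambda>(p, q). (snd c p, snd d q))) ` (A \<times> B)"

section \<open>Tensor fields\<close>

text \<open>A tangent vector at \<open>p\<close> is given by its components (an element of the model space \<open>'e\<close>) in
  each chart around \<open>p\<close>, related by the differentials of the coordinate changes; tensor fields are
  given by their components in each chart, with the corresponding transformation law.
  \<open>differential c d F p\<close> is the differential of \<open>F\<close> at \<open>p\<close> with respect to a chart \<open>c\<close> around \<open>p\<close>
  and a chart \<open>d\<close> around \<open>F p\<close>.\<close>

definition differential ::
    "('a, 'e::euclidean_space) chart \<Rightarrow> ('b, 'f::euclidean_space) chart \<Rightarrow> ('a \<Rightarrow> 'b) \<Rightarrow>
     'a \<Rightarrow> 'e \<Rightarrow> 'f"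
  where "differential c d F p u = dir_deriv (snd d \<circ> F \<circ> cinv c) (snd c p) u"

type_synonym ('a, 'e) vfield = "('a, 'e) chart \<Rightarrow> 'a \<Rightarrow> 'e"

type_synonym ('a, 'e) tensor2 = "('a, 'e) chart \<Rightarrow> 'a \<Rightarrow> 'e \<Rightarrow> 'e \<Rightarrow> real"

definition smooth_vector_field ::
    "('a, 'e::euclidean_space) chart set \<Rightarrow> ('a, 'e) vfield \<Rightarrow> bool"
  where "smooth_vector_field A X \<longleftrightarrow>
    (\<forall>c\<in>A. \<forall>d\<in>A. \<forall>p \<in> fst c \<inter> fst d. X d p = differential c d id p (X c p)) \<and>
    (\<forall>c\<in>A. smooth_on (X c \<circ> cinv c) (cimage c))"

definition riemannian_metric ::
    "('a, 'e::euclidean_space) chart set \<Rightarrow> ('a, 'e) tensor2 \<Rightarrow> bool"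
  where "riemannian_metric A g \<longleftrightarrow>
    (\<forall>c\<in>A. \<forall>p \<in> fst c. bilinear (g c p) \<and> (\<forall>u v. g c p u v = g c p v u) \<and>
       (\<forall>u. u \<noteq> 0 \<longrightarrow> g c p u u > 0)) \<and>
    (\<forall>c\<in>A. \<forall>d\<in>A. \<forall>p \<in> fst c \<inter> fst d. \<forall>u v.
       g d p (differential c d id p u) (differential c d id p v) = g c p u v) \<and>
    (\<forall>c\<in>A. \<forall>u v. smooth_on (\<lambda>x. g c (cinv c x) u v) (cimage c))"

section \<open>Riemannian geometry in coordinates\<close>

text \<open>Here \<open>h x u v\<close> is a metric on an open subset of \<open>'e\<close>. Vectors \<open>u, v, w\<close> are also regarded as
  constant (coordinate) vector fields; these commute, so the Koszul formula for the Levi-Civita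
  connection reads 2 h(D_u v, w) = u h(v, w) + v h(u, w) - w h(u, v), and \<open>christoffel h x u v\<close>
  is the covariant derivative D_u v at \<open>x\<close>.\<close>

definition christoffel ::
    "('e::euclidean_space \<Rightarrow> 'e \<Rightarrow> 'e \<Rightarrow> real) \<Rightarrow> 'e \<Rightarrow> 'e \<Rightarrow> 'e \<Rightarrow> 'e"
  where "christoffel h x u v = (THE y. \<forall>w. 2 * h x y w =
    dir_deriv (\<lambda>z. h z v w) x u + dir_deriv (\<lambda>z. h z u w) x v - dir_deriv (\<lambda>z. h z u v) x w)"

text \<open>R(u, v) w = D_u D_v w - D_v D_u w for constant fields.\<close>

definition riemann_coord ::
    "('e::euclidean_space \<Rightarrow> 'e \<Rightarrow> 'e \<Rightarrow> real) \<Rightarrow> 'e \<Rightarrow> 'e \<Rightarrow> 'e \<Rightarrow> 'e \<Rightarrow> 'e"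
  where "riemann_coord h x u v w =
    (dir_deriv (\<lambda>z. christoffel h z v w) x u + christoffel h x u (christoffel h x v w)) -
    (dir_deriv (\<lambda>z. christoffel h z u w) x v + christoffel h x v (christoffel h x u w))"

text \<open>The trace of the endomorphism \<open>b \<mapsto> R(b, v) w\<close>; being a trace, it does not depend on the
  inner product of the model space used to compute it.\<close>

definition ricci_coord ::
    "('e::euclidean_space \<Rightarrow> 'e \<Rightarrow> 'e \<Rightarrow> real) \<Rightarrow> 'e \<Rightarrow> 'e \<Rightarrow> 'e \<Rightarrow> real"
  where "ricci_coord h x v w = (\<Sum>b\<in>Basis. riemann_coord h x b v w \<bullet> b)"

text \<open>Hess f (u, v) = u (v f) - (D_u v) f.\<close>

definition hessian_coord ::
    "('e::euclidean_space \<Rightarrow> 'e \<Rightarrow> 'e \<Rightarrow> real) \<Rightarrow> ('e \<Rightarrow> real) \<Rightarrow> 'e \<Rightarrow> 'e \<Rightarrow> 'e \<Rightarrow> real"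
  where "hessian_coord h \<phi> x u v =
    dir_deriv (\<lambda>z. dir_deriv \<phi> z v) x u - dir_deriv \<phi> x (christoffel h x u v)"

text \<open>(L_X h)(u, v) = X h(u, v) - h([X, u], v) - h(u, [X, v]), where [X, u] = - d X(u) for a constant
  field \<open>u\<close>.\<close>

definition lie_derivative_coord ::
    "('e::euclidean_space \<Rightarrow> 'e) \<Rightarrow> ('e \<Rightarrow> 'e \<Rightarrow> 'e \<Rightarrow> real) \<Rightarrow> 'e \<Rightarrow> 'e \<Rightarrow> 'e \<Rightarrow> real"
  where "lie_derivative_coord X h x u v =
    dir_deriv (\<lambda>z. h z u v) x (X x) + h x (dir_deriv X x u) v + h x u (dir_deriv X x v)"

section \<open>Ricci tensor, Hessian, Lie derivative, solitons\<close>

abbreviation local_metric ::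
    "('a, 'e) tensor2 \<Rightarrow> ('a, 'e) chart \<Rightarrow> 'e \<Rightarrow> 'e \<Rightarrow> 'e \<Rightarrow> real"
  where "local_metric g c \<equiv> (\<lambda>x. g c (cinv c x))"

definition ricci :: "('a, 'e::euclidean_space) tensor2 \<Rightarrow> ('a, 'e) tensor2"
  where "ricci g c p = ricci_coord (local_metric g c) (snd c p)"

definition hessian :: "('a, 'e::euclidean_space) tensor2 \<Rightarrow> ('a \<Rightarrow> real) \<Rightarrow> ('a, 'e) tensor2"
  where "hessian g f c p = hessian_coord (local_metric g c) (f \<circ> cinv c) (snd c p)"

definition lie_derivative ::
    "('a, 'e::euclidean_space) vfield \<Rightarrow> ('a, 'e) tensor2 \<Rightarrow> ('a, 'e) tensor2"
  where "lie_derivative X g c p =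
    lie_derivative_coord (X c \<circ> cinv c) (local_metric g c) (snd c p)"

definition lie_bracket ::
    "('a, 'e::euclidean_space) vfield \<Rightarrow> ('a, 'e) vfield \<Rightarrow> ('a, 'e) vfield"
  where "lie_bracket X Y c p =
    dir_deriv (Y c \<circ> cinv c) (snd c p) (X c p) - dir_deriv (X c \<circ> cinv c) (snd c p) (Y c p)"

definition ricci_soliton :: "('a, 'e::euclidean_space) chart set \<Rightarrow> ('a, 'e) tensor2 \<Rightarrow> bool"
  where "ricci_soliton A g \<longleftrightarrow> riemannian_metric A g \<and>
    (\<exists>X l. smooth_vector_field A X \<and> (\<forall>c\<in>A. \<forall>p \<in> fst c. \<forall>u v.
       ricci g c p u v + 1/2 * lie_derivative X g c p u v = l * g c p u v))"

section \<open>Lie groups\<close>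

locale lie_group = group G + smooth_manifold T A
  for G :: "('a, 'm) monoid_scheme" (structure)
    and T :: "'a topology" and A :: "('a, 'e::euclidean_space) chart set" +
  assumes topspace_eq: "topspace T = carrier G"
    and smooth_mult:
      "smooth_map (prod_topology T T) (product_atlas A A) T A (\<lambda>(x, y). x \<otimes> y)"
    and smooth_inv: "smooth_map T A T A (\<lambda>x. inv x)"

primrec lower_central :: "('a, 'm) monoid_scheme \<Rightarrow> nat \<Rightarrow> 'a set" where
  "lower_central G 0 = carrier G"
| "lower_central G (Suc n) = generate G
     {x \<otimes>\<^bsub>G\<^esub> y \<otimes>\<^bsub>G\<^esub> inv\<^bsub>G\<^esub> x \<otimes>\<^bsub>G\<^esub> inv\<^bsub>G\<^esub> y | x y. x \<in> carrier G \<and> y \<in> lower_central G n}"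

definition nilpotent_group :: "('a, 'm) monoid_scheme \<Rightarrow> bool"
  where "nilpotent_group G \<longleftrightarrow> group G \<and> (\<exists>n. lower_central G n = {\<one>\<^bsub>G\<^esub>})"

definition left_invariant_metric ::
    "('a, 'm) monoid_scheme \<Rightarrow> ('a, 'e::euclidean_space) chart set \<Rightarrow> ('a, 'e) tensor2 \<Rightarrow> bool"
  where "left_invariant_metric G A g \<longleftrightarrow>
    (\<forall>a \<in> carrier G. \<forall>c\<in>A. \<forall>d\<in>A. \<forall>p \<in> fst c. a \<otimes>\<^bsub>G\<^esub> p \<in> fst d \<longrightarrow> (\<forall>u v.
       g d (a \<otimes>\<^bsub>G\<^esub> p) (differential c d (\<lambda>x. a \<otimes>\<^bsub>G\<^esub> x) p u)
                        (differential c d (\<lambda>x. a \<otimes>\<^bsub>G\<^esub> x) p v) = g c p u v))"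

definition left_invariant_field ::
    "('a, 'm) monoid_scheme \<Rightarrow> ('a, 'e::euclidean_space) chart set \<Rightarrow> ('a, 'e) vfield \<Rightarrow> bool"
  where "left_invariant_field G A X \<longleftrightarrow> smooth_vector_field A X \<and>
    (\<forall>a \<in> carrier G. \<forall>c\<in>A. \<forall>d\<in>A. \<forall>p \<in> fst c. a \<otimes>\<^bsub>G\<^esub> p \<in> fst d \<longrightarrow>
       X d (a \<otimes>\<^bsub>G\<^esub> p) = differential c d (\<lambda>x. a \<otimes>\<^bsub>G\<^esub> x) p (X c p))"

text \<open>The Lie algebra of \<open>G\<close> consists of the left invariant vector fields. For connected \<open>G\<close> it is
  abelian if and only if \<open>G\<close> is; in general, if and only if the identity component of \<open>G\<close> is.\<close>

definition abelian_lie_algebra ::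
    "('a, 'm) monoid_scheme \<Rightarrow> ('a, 'e::euclidean_space) chart set \<Rightarrow> bool"
  where "abelian_lie_algebra G A \<longleftrightarrow>
    (\<forall>X Y. left_invariant_field G A X \<longrightarrow> left_invariant_field G A Y \<longrightarrow>
       (\<forall>c\<in>A. \<forall>p \<in> fst c. lie_bracket X Y c p = 0))"

end

theory Submission
  imports Defs
begin

text \<open>Write the gradient of the potential in a left invariant frame as a function \<open>F\<close> with values in
  the metric Lie algebra. The soliton equation becomes \<open>X\<^sub>u F = D u - \<nabla>\<^sub>u F\<close> with
  \<open>D = \<lambda> - Ric\<close> constant, and its integrability condition makes \<open>R(u, v) F\<close> constant. Hence the
  differences of the values of \<open>F\<close> span a subspace \<open>P\<close> that is invariant under all \<open>\<nabla>\<^sub>u\<close> and killed by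
  the curvature, and \<open>D u - \<nabla>\<^sub>u F\<close> lies in \<open>P\<close>. If \<open>\<nabla>\<^sub>u u = 0\<close>, then taking the component of \<open>u\<close>
  orthogonal to \<open>P\<close> shows that \<open>Ric(u, u)\<close> is a nonnegative multiple of \<open>\<lambda>\<close>.

  For such \<open>u\<close> moreover \<open>Ric(u, u) = - tr (B\<^sup>2)\<close> with \<open>B = \<nabla>u\<close>. A central \<open>u\<close> in the last nonzero term
  of the lower central series has \<open>B\<close> skew and nonzero, so \<open>Ric(u, u) > 0\<close> and \<open>\<lambda> > 0\<close>. If \<open>u\<close> is
  orthogonal to the commutator ideal, \<open>B\<close> is symmetric, so \<open>Ric(u, u) \<le> 0\<close>, which forces \<open>B = 0\<close>;
  then \<open>ad u\<close> is skew and nilpotent, hence zero. So the Lie algebra is the sum of its centre and its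
  commutator ideal, and a nilpotent Lie algebra with this property is abelian.\<close>

section \<open>Calculus\<close>

lemma dir_deriv_works:
  "F differentiable (at x) \<Longrightarrow> (F has_derivative dir_deriv F x) (at x)"
  by (simp add: frechet_derivative_works)

lemma dir_deriv_eq: "(F has_derivative D) (at x) \<Longrightarrow> dir_deriv F x = D"
  using frechet_derivative_at by metis

lemma dir_deriv_apply: "(F has_derivative D) (at x) \<Longrightarrow> dir_deriv F x u = D u"
  by (simp add: dir_deriv_eq)

section \<open>Closure properties of the classes C^k\<close>

lemma Ck_on_cong:
  assumes "open S" "\<And>x. x \<in> S \<Longrightarrow> F x = G x" "Ck_on k F S"
  shows "Ck_on k G S"
  using assms(2,3)
proof (induction k arbitrary: F G)
  case 0
  then show ?case using continuous_on_cong[of S S F G] by simp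
next
  case (Suc k)
  have D: "(G has_derivative dir_deriv F x) (at x)" if "x \<in> S" for x
    using has_derivative_transform_within_open[OF dir_deriv_works assms(1) that] Suc.prems that
    by auto
  have "Ck_on k (\<lambda>x. dir_deriv G x u) S" for u
  proof (rule Suc.IH)
    show "dir_deriv F x u = dir_deriv G x u" if "x \<in> S" for x
      by (simp only: dir_deriv_eq[OF D[OF that]])
    show "Ck_on k (\<lambda>x. dir_deriv F x u) S"
      using Suc.prems(2) by simp
  qed
  then show ?case
    using differentiableI[OF D] by simp
qed

lemma Ck_onI:
  assumes "open S" "\<And>x. x \<in> S \<Longrightarrow> (F has_derivative F' x) (at x)"
    and "\<And>u. Ck_on k (\<lambda>x. F' x u) S"
  shows "Ck_on (Suc k) F S"
proof -
  have "F' x u = dir_deriv F x u" if "x \<in> S" for x u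
    by (simp only: dir_deriv_eq[OF assms(2)[OF that]])
  then have "Ck_on k (\<lambda>x. dir_deriv F x u) S" for u
    by (intro Ck_on_cong[OF assms(1) _ assms(3)])
  then show ?thesis
    using differentiableI[OF assms(2)] by simp
qed

lemma Ck_on_Suc_imp: "Ck_on (Suc k) F S \<Longrightarrow> Ck_on k F S"
  by (induction k arbitrary: F)
    (auto intro!: continuous_at_imp_continuous_on differentiable_imp_continuous_within)

lemma Ck_on_subset: "Ck_on k F S \<Longrightarrow> T \<subseteq> S \<Longrightarrow> Ck_on k F T"
  by (induction k arbitrary: F) (auto intro: continuous_on_subset)

lemma Ck_on_Suc_D:
  assumes "Ck_on (Suc k) F S"
  shows "x \<in> S \<Longrightarrow> (F has_derivative dir_deriv F x) (at x)" "Ck_on k (\<lambda>x. dir_deriv F x u) S"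
  using assms dir_deriv_works by auto

lemma Ck_on_const: "open S \<Longrightarrow> Ck_on k (\<lambda>x. c) S"
  by (induction k arbitrary: c) (auto intro!: Ck_onI)

lemma Ck_on_bounded_linear:
  assumes "open S" "bounded_linear h"
  shows "Ck_on k h S"
proof (cases k)
  case 0
  then show ?thesis using assms by (simp add: linear_continuous_on)
next
  case (Suc j)
  have "Ck_on (Suc j) h S"
    by (rule Ck_onI[OF assms(1) bounded_linear_imp_has_derivative[OF assms(2)]])
      (rule Ck_on_const[OF assms(1)])
  then show ?thesis using Suc by simp
qed

lemma Ck_on_add:
  assumes "open S"
  shows "Ck_on k F S \<Longrightarrow> Ck_on k G S \<Longrightarrow> Ck_on k (\<lambda>x. F x + G x) S"
proof (induction k arbitrary: F G)
  case 0
  then show ?case by (simp add: continuous_on_add)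
next
  case (Suc k)
  show ?case
    by (rule Ck_onI[OF assms has_derivative_add[OF Ck_on_Suc_D(1)[OF Suc.prems(1)]
            Ck_on_Suc_D(1)[OF Suc.prems(2)]]])
      (use Suc in auto)
qed

lemma Ck_on_scaleR:
  fixes f :: "'a::real_normed_vector \<Rightarrow> real"
  assumes "open S"
  shows "Ck_on k f S \<Longrightarrow> Ck_on k G S \<Longrightarrow> Ck_on k (\<lambda>x. f x *\<^sub>R G x) S"
proof (induction k arbitrary: f G)
  case 0
  then show ?case by (simp add: continuous_on_scaleR)
next
  case (Suc k)
  show ?case
  proof (rule Ck_onI[OF assms])
    show "((\<lambda>x. f x *\<^sub>R G x) has_derivative
        (\<lambda>u. f x *\<^sub>R dir_deriv G x u + dir_deriv f x u *\<^sub>R G x)) (at x)" if "x \<in> S" for x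
      by (rule has_derivative_scaleR[OF Ck_on_Suc_D(1)[OF Suc.prems(1) that]
            Ck_on_Suc_D(1)[OF Suc.prems(2) that]])
    show "Ck_on k (\<lambda>x. f x *\<^sub>R dir_deriv G x u + dir_deriv f x u *\<^sub>R G x) S" for u
      by (intro Ck_on_add[OF assms] Suc.IH Ck_on_Suc_imp[OF Suc.prems(1)]
        Ck_on_Suc_imp[OF Suc.prems(2)] Ck_on_Suc_D(2)[OF Suc.prems(1)]
        Ck_on_Suc_D(2)[OF Suc.prems(2)])
  qed
qed

lemma Ck_on_sum:
  assumes "open S" "\<And>i. i \<in> I \<Longrightarrow> Ck_on k (F i) S"
  shows "Ck_on k (\<lambda>x. \<Sum>i\<in>I. F i x) S"
  using assms(2)
  by (induction I rule: infinite_finite_induct)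
    (simp_all add: Ck_on_const[OF assms(1)] Ck_on_add[OF assms(1)])

lemma Ck_on_linear_compose:
  assumes "open S" "bounded_linear h"
  shows "Ck_on k F S \<Longrightarrow> Ck_on k (\<lambda>x. h (F x)) S"
proof (induction k arbitrary: F)
  case 0
  then show ?case
    using bounded_linear.continuous_on[OF assms(2)] by auto
next
  case (Suc k)
  show ?case
    by (rule Ck_onI[OF assms(1) bounded_linear.has_derivative[OF assms(2)
            Ck_on_Suc_D(1)[OF Suc.prems]]])
      (use Suc in auto)
qed

lemma Ck_on_Pair:
  assumes "open S"
  shows "Ck_on k F S \<Longrightarrow> Ck_on k G S \<Longrightarrow> Ck_on k (\<lambda>x. (F x, G x)) S"
proof (induction k arbitrary: F G)
  case 0
  then show ?case by (simp add: continuous_on_Pair)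
next
  case (Suc k)
  show ?case
    by (rule Ck_onI[OF assms has_derivative_Pair[OF Ck_on_Suc_D(1)[OF Suc.prems(1)]
            Ck_on_Suc_D(1)[OF Suc.prems(2)]]])
      (use Suc in auto)
qed

text \<open>By the chain rule the derivative of the composite is
  \<open>dir_deriv F (G x) (dir_deriv G x u)\<close>, whose inner direction varies with
  \<open>x\<close>. Expanding that direction over the basis of the middle space leaves products of
  C^k functions with derivatives of \<open>F\<close> in fixed directions, to which the induction
  hypothesis applies.\<close>

lemma Ck_on_compose:
  fixes G :: "'a::real_normed_vector \<Rightarrow> 'b::euclidean_space"
  assumes "open S"
  shows "Ck_on k F T \<Longrightarrow> Ck_on k G S \<Longrightarrow> G ` S \<subseteq> T \<Longrightarrow> Ck_on k (\<lambda>x. F (G x)) S"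
proof (induction k arbitrary: F)
  case 0
  then show ?case
    using continuous_on_compose2[of T F S G] by simp
next
  case (Suc k)
  have expand: "dir_deriv F y v = (\<Sum>b\<in>Basis. (v \<bullet> b) *\<^sub>R dir_deriv F y b)" if "y \<in> T" for y v
  proof -
    have lin: "linear (dir_deriv F y)"
      using Ck_on_Suc_D(1)[OF Suc.prems(1) that] has_derivative_linear by blast
    have "dir_deriv F y v = dir_deriv F y (\<Sum>b\<in>Basis. (v \<bullet> b) *\<^sub>R b)"
      by (simp add: euclidean_representation)
    then show ?thesis by (simp add: linear_sum[OF lin] linear_scale[OF lin])
  qed
  have GT: "G x \<in> T" if "x \<in> S" for x using Suc.prems(3) that by auto
  show ?case
  proof (rule Ck_onI[OF assms, where F' = "\<lambda>x u. dir_deriv F (G x) (dir_deriv G x u)"])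
    show "((\<lambda>x. F (G x)) has_derivative (\<lambda>u. dir_deriv F (G x) (dir_deriv G x u))) (at x)"
      if "x \<in> S" for x
      using diff_chain_at[OF Ck_on_Suc_D(1)[OF Suc.prems(2) that]
          Ck_on_Suc_D(1)[OF Suc.prems(1) GT[OF that]]] by (simp add: o_def)
    show "Ck_on k (\<lambda>x. dir_deriv F (G x) (dir_deriv G x u)) S" for u
    proof (rule Ck_on_cong[OF assms])
      show "(\<Sum>b\<in>Basis. (dir_deriv G x u \<bullet> b) *\<^sub>R dir_deriv F (G x) b)
        = dir_deriv F (G x) (dir_deriv G x u)" if "x \<in> S" for x
        using expand[OF GT[OF that], of "dir_deriv G x u"] by simp
      show "Ck_on k (\<lambda>x. \<Sum>b\<in>Basis. (dir_deriv G x u \<bullet> b) *\<^sub>R dir_deriv F (G x) b) S"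
      proof (intro Ck_on_sum[OF assms] Ck_on_scaleR[OF assms])
        fix b :: 'b
        show "Ck_on k (\<lambda>x. dir_deriv G x u \<bullet> b) S"
          by (rule Ck_on_linear_compose[OF assms bounded_linear_inner_left Ck_on_Suc_D(2)])
            (rule Suc.prems(2))
        show "Ck_on k (\<lambda>x. dir_deriv F (G x) b) S"
          by (rule Suc.IH[OF Ck_on_Suc_D(2)[OF Suc.prems(1)] Ck_on_Suc_imp[OF Suc.prems(2)]
                Suc.prems(3)])
      qed
    qed
  qed
qed

section \<open>Symmetry of second derivatives\<close>

text \<open>The mean value theorem along \<open>u\<close> turns the second difference into
  \<open>t\<close> times an increment of the derivative in direction \<open>u\<close>;
  differentiability of that derivative at the single point \<open>x\<close> then estimates the
  increment.\<close>

lemma second_difference: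
  fixes f :: "'a::real_normed_vector \<Rightarrow> real"
  assumes "open S" "x \<in> S" "\<And>z. z \<in> S \<Longrightarrow> f differentiable (at z)"
    and L: "((\<lambda>z. dir_deriv f z u) has_derivative L) (at x)" and "e > 0"
  shows "\<exists>d>0. \<forall>t. 0 < t \<and> t < d \<longrightarrow>
    \<bar>f (x + t *\<^sub>R u + t *\<^sub>R v) - f (x + t *\<^sub>R u) - f (x + t *\<^sub>R v) + f x - t\<^sup>2 * L v\<bar> \<le> e * t\<^sup>2"
proof -
  \<comment> \<open>\<open>t * K\<close> bounds the sum of the norms of the two increments
    \<open>s *\<^sub>R u + t *\<^sub>R v\<close> and \<open>s *\<^sub>R u\<close> for
    \<open>s\<close> below \<open>t\<close>; the summand 1 keeps \<open>K\<close> positive.\<close>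
  define K where "K = 2 * norm u + norm v + 1"
  have K: "K > 0" unfolding K_def by (simp add: add_nonneg_pos)
  obtain r where r: "r > 0" "ball x r \<subseteq> S"
    using assms(1,2) openE by blast
  have lin: "linear L" using L has_derivative_linear by blast
  obtain d1 where d1: "d1 > 0" "\<And>y. norm (y - x) < d1 \<Longrightarrow>
      \<bar>dir_deriv f y u - dir_deriv f x u - L (y - x)\<bar> \<le> (e / K) * norm (y - x)"
    using L \<open>e > 0\<close> K unfolding has_derivative_at_alt real_norm_def
    by (meson divide_pos_pos)
  define d where "d = min r d1 / K"
  have d: "d > 0" using r d1 K by (simp add: d_def)
  show ?thesis
  proof (intro exI[of _ d] conjI d allI impI)
    fix t assume t: "0 < t \<and> t < d"
    then have tK: "t * K < r" "t * K < d1"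
      using K by (simp_all add: d_def pos_less_divide_eq)
    have small: "norm (s *\<^sub>R u + c *\<^sub>R v) < r" "norm (s *\<^sub>R u + c *\<^sub>R v) < d1"
      if "0 \<le> s" "s \<le> t" "0 \<le> c" "c \<le> t" for s c
    proof -
      have "norm (s *\<^sub>R u + c *\<^sub>R v) \<le> s * norm u + c * norm v"
        using that norm_triangle_ineq[of "s *\<^sub>R u" "c *\<^sub>R v"] by simp
      also have "\<dots> \<le> t * norm u + t * norm v"
        using that by (intro add_mono mult_right_mono) auto
      also have "\<dots> \<le> t * K"
        using t unfolding K_def by (simp add: algebra_simps)
      finally show "norm (s *\<^sub>R u + c *\<^sub>R v) < r" "norm (s *\<^sub>R u + c *\<^sub>R v) < d1"
        using tK by auto
    qed
    have inS: "x + s *\<^sub>R u + c *\<^sub>R v \<in> S" if "0 \<le> s" "s \<le> t" "0 \<le> c" "c \<le> t" for s c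
    proof -
      have "x + s *\<^sub>R u + c *\<^sub>R v \<in> ball x r"
        using small(1)[OF that] by (simp add: dist_norm norm_minus_commute algebra_simps)
      then show ?thesis using r by auto
    qed
    have deriv: "((\<lambda>s. f (x + s *\<^sub>R u + c *\<^sub>R v)) has_real_derivative
        dir_deriv f (x + s *\<^sub>R u + c *\<^sub>R v) u) (at s)"
      if "0 \<le> s" "s \<le> t" "0 \<le> c" "c \<le> t" for s c
    proof -
      have fd: "(f has_derivative dir_deriv f (x + s *\<^sub>R u + c *\<^sub>R v)) (at (x + s *\<^sub>R u + c *\<^sub>R v))"
        using assms(3)[OF inS[OF that]] dir_deriv_works by blast
      have "((\<lambda>s. x + s *\<^sub>R u + c *\<^sub>R v) has_derivative (\<lambda>h. h *\<^sub>R u)) (at s)"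
        by (auto intro!: derivative_eq_intros)
      from diff_chain_at[OF this fd]
      have "((\<lambda>s. f (x + s *\<^sub>R u + c *\<^sub>R v)) has_derivative
          (\<lambda>h. dir_deriv f (x + s *\<^sub>R u + c *\<^sub>R v) (h *\<^sub>R u))) (at s)"
        by (simp add: o_def)
      then show ?thesis
        by (simp add: has_field_derivative_def linear_scale[OF has_derivative_linear[OF fd]]
            mult_commute_abs)
    qed
    define D where "D s = dir_deriv f (x + s *\<^sub>R u + t *\<^sub>R v) u - dir_deriv f (x + s *\<^sub>R u + 0 *\<^sub>R v) u" for s
    obtain s where s: "0 < s" "s < t"
      "(f (x + t *\<^sub>R u + t *\<^sub>R v) - f (x + t *\<^sub>R u + 0 *\<^sub>R v))
        - (f (x + 0 *\<^sub>R u + t *\<^sub>R v) - f (x + 0 *\<^sub>R u + 0 *\<^sub>R v)) = (t - 0) * D s"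
      using MVT2[of 0 t "\<lambda>s. f (x + s *\<^sub>R u + t *\<^sub>R v) - f (x + s *\<^sub>R u + 0 *\<^sub>R v)" D]
        t deriv by (fastforce simp: D_def intro: DERIV_diff)
    have near: "\<bar>dir_deriv f (x + s *\<^sub>R u + c *\<^sub>R v) u - dir_deriv f x u - L (s *\<^sub>R u + c *\<^sub>R v)\<bar>
        \<le> (e / K) * norm (s *\<^sub>R u + c *\<^sub>R v)" if "c = t \<or> c = 0" for c
      using d1(2)[of "x + s *\<^sub>R u + c *\<^sub>R v"] small(2)[of s c] s t that by (auto simp: add.assoc)
    \<comment> \<open>Both derivatives in \<open>D s\<close> are compared with the linear
      approximation at \<open>x\<close>. Their increments differ by \<open>t *\<^sub>R v\<close>, so
      the linear parts leave exactly \<open>t * L v\<close>.\<close>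
    have "\<bar>D s - t * L v\<bar> \<le> (e / K) * norm (s *\<^sub>R u + t *\<^sub>R v) + (e / K) * norm (s *\<^sub>R u + 0 *\<^sub>R v)"
      using near[of t] near[of 0] unfolding D_def
      by (simp add: linear_add[OF lin] linear_scale[OF lin] linear_0[OF lin])
    also have "\<dots> = (e / K) * (norm (s *\<^sub>R u + t *\<^sub>R v) + norm (s *\<^sub>R u))"
      by (simp add: algebra_simps)
    also have "\<dots> \<le> (e / K) * (t * K)"
    proof (rule mult_left_mono)
      have "norm (s *\<^sub>R u + t *\<^sub>R v) + norm (s *\<^sub>R u) \<le> 2 * (s * norm u) + t * norm v"
        using s t norm_triangle_ineq[of "s *\<^sub>R u" "t *\<^sub>R v"] by simp
      also have "\<dots> \<le> 2 * (t * norm u) + t * norm v"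
        using s by (simp add: mult_right_mono)
      also have "\<dots> \<le> t * K" using t by (simp add: K_def algebra_simps)
      finally show "norm (s *\<^sub>R u + t *\<^sub>R v) + norm (s *\<^sub>R u) \<le> t * K" .
      show "0 \<le> e / K" using \<open>e > 0\<close> K by simp
    qed
    also have "\<dots> = e * t" using K by simp
    finally have "\<bar>D s - t * L v\<bar> \<le> e * t" .
    then have "t * \<bar>D s - t * L v\<bar> \<le> t * (e * t)"
      using t by (intro mult_left_mono) auto
    moreover have "t * \<bar>D s - t * L v\<bar> = \<bar>t * D s - t\<^sup>2 * L v\<bar>"
      using t by (simp add: abs_mult_pos' algebra_simps power2_eq_square)
    moreover have "f (x + t *\<^sub>R u + t *\<^sub>R v) - f (x + t *\<^sub>R u) - f (x + t *\<^sub>R v) + f x = t * D s"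
      using s(3) by simp
    ultimately show "\<bar>f (x + t *\<^sub>R u + t *\<^sub>R v) - f (x + t *\<^sub>R u) - f (x + t *\<^sub>R v) + f x - t\<^sup>2 * L v\<bar>
        \<le> e * t\<^sup>2"
      by (simp add: power2_eq_square algebra_simps)
  qed
qed

text \<open>The second difference is symmetric in \<open>u\<close> and \<open>v\<close>, so
  \<open>t\<^sup>2 * L v\<close> and \<open>t\<^sup>2 * M u\<close> both approximate it. With an
  error of a third of the gap on each side, the two cannot differ.\<close>

lemma second_derivative_symmetric_real:
  fixes f :: "'a::real_normed_vector \<Rightarrow> real"
  assumes "open S" "x \<in> S" "\<And>z. z \<in> S \<Longrightarrow> f differentiable (at z)"
    and "((\<lambda>z. dir_deriv f z u) has_derivative L) (at x)"
    and "((\<lambda>z. dir_deriv f z v) has_derivative M) (at x)"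
  shows "L v = M u"
proof (rule ccontr)
  assume "L v \<noteq> M u"
  define e where "e = \<bar>L v - M u\<bar> / 3"
  have e: "e > 0" using \<open>L v \<noteq> M u\<close> by (simp add: e_def)
  obtain d1 where d1: "d1 > 0" "\<And>t. 0 < t \<Longrightarrow> t < d1 \<Longrightarrow>
    \<bar>f (x + t *\<^sub>R u + t *\<^sub>R v) - f (x + t *\<^sub>R u) - f (x + t *\<^sub>R v) + f x - t\<^sup>2 * L v\<bar> \<le> e * t\<^sup>2"
    using second_difference[OF assms(1-4) e] by blast
  obtain d2 where d2: "d2 > 0" "\<And>t. 0 < t \<Longrightarrow> t < d2 \<Longrightarrow>
    \<bar>f (x + t *\<^sub>R v + t *\<^sub>R u) - f (x + t *\<^sub>R v) - f (x + t *\<^sub>R u) + f x - t\<^sup>2 * M u\<bar> \<le> e * t\<^sup>2"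
    using second_difference[OF assms(1-3,5) e] by blast
  define t where "t = min d1 d2 / 2"
  have t: "0 < t" "t < d1" "t < d2" using d1 d2 by (auto simp: t_def)
  define s where "s = t\<^sup>2"
  have s: "s > 0" using t by (simp add: s_def)
  have "x + t *\<^sub>R v + t *\<^sub>R u = x + t *\<^sub>R u + t *\<^sub>R v" by (simp add: algebra_simps)
  then have "\<bar>s * L v - s * M u\<bar> \<le> 2 * (e * s)"
    using d1(2)[OF t(1,2)] d2(2)[OF t(1,3)] unfolding s_def[symmetric] by (smt (verit))
  moreover have "\<bar>s * L v - s * M u\<bar> = s * \<bar>L v - M u\<bar>"
    using s by (simp add: abs_mult right_diff_distrib[symmetric])
  ultimately have "s * (3 * e) \<le> s * (2 * e)" by (simp add: e_def algebra_simps)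
  then show False using s e by simp
qed

lemma dir_deriv_inner:
  "F differentiable (at x) \<Longrightarrow> dir_deriv (\<lambda>z. F z \<bullet> b) x u = dir_deriv F x u \<bullet> b"
  using dir_deriv_eq[OF has_derivative_inner_left[OF dir_deriv_works]] by metis

text \<open>The real case is applied to each component. Pointwise differentiability of the first
  derivatives is the form suited to the gradient \<open>F\<close> below, whose second derivatives
  come from its differential equation.\<close>

lemma second_derivative_symmetric:
  fixes F :: "'a::real_normed_vector \<Rightarrow> 'b::euclidean_space"
  assumes "open S" "x \<in> S" "\<And>z. z \<in> S \<Longrightarrow> F differentiable (at z)"
    and diff: "\<And>u. (\<lambda>z. dir_deriv F z u) differentiable (at x)"
  shows "dir_deriv (\<lambda>z. dir_deriv F z u) x v = dir_deriv (\<lambda>z. dir_deriv F z v) x u"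
proof (rule euclidean_eqI)
  fix b :: 'b
  have eq: "dir_deriv (\<lambda>z. F z \<bullet> b) z u = dir_deriv F z u \<bullet> b" if "z \<in> S" for z u
    using dir_deriv_inner[OF assms(3)[OF that]] .
  have D: "((\<lambda>z. dir_deriv (\<lambda>z. F z \<bullet> b) z u) has_derivative
      (\<lambda>v. dir_deriv (\<lambda>z. dir_deriv F z u) x v \<bullet> b)) (at x)" for u
    by (rule has_derivative_transform_within_open[OF
          has_derivative_inner_left[OF dir_deriv_works[OF diff]] assms(1,2)])
      (simp add: eq)
  have "(\<lambda>z. F z \<bullet> b) differentiable (at z)" if "z \<in> S" for z
    using has_derivative_inner_left[OF dir_deriv_works[OF assms(3)[OF that]]] differentiableI
    by blast
  from second_derivative_symmetric_real[OF assms(1,2) this D D]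
  show "dir_deriv (\<lambda>z. dir_deriv F z u) x v \<bullet> b = dir_deriv (\<lambda>z. dir_deriv F z v) x u \<bullet> b" .
qed

lemma Ck_on_symmetric:
  fixes F :: "'a::real_normed_vector \<Rightarrow> 'b::euclidean_space"
  assumes "open S" "x \<in> S" "Ck_on (Suc (Suc k)) F S"
  shows "dir_deriv (\<lambda>z. dir_deriv F z u) x v = dir_deriv (\<lambda>z. dir_deriv F z v) x u"
  by (rule second_derivative_symmetric[OF assms(1,2)]) (use assms in auto)

section \<open>Derivatives of varying linear maps, of subspace-valued maps and of germs\<close>

text \<open>Product rule for a varying linear map applied to a varying vector, when the map is
  differentiated only at fixed arguments. Expanding the vector over the basis reduces it to finitely
  many products.\<close>

lemma has_derivative_apply:
  fixes A :: "'a::real_normed_vector \<Rightarrow> 'b::euclidean_space \<Rightarrow> 'c::real_normed_vector"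
  assumes S: "open S" "x \<in> S" and lin: "\<And>z. z \<in> S \<Longrightarrow> linear (A z)"
    and A: "\<And>w. ((\<lambda>z. A z w) has_derivative (\<lambda>u. A' u w)) (at x)"
    and Y: "(Y has_derivative Y') (at x)"
  shows "((\<lambda>z. A z (Y z)) has_derivative (\<lambda>u. A' u (Y x) + A x (Y' u))) (at x)"
proof -
  have expand: "L v = (\<Sum>b\<in>Basis. (v \<bullet> b) *\<^sub>R L b)" if "linear L" for L :: "'b \<Rightarrow> 'c" and v
    using linear_sum[OF that, of "\<lambda>b. (v \<bullet> b) *\<^sub>R b" Basis]
    by (simp add: euclidean_representation linear_scale[OF that])
  have sum: "((\<lambda>z. \<Sum>b\<in>Basis. (Y z \<bullet> b) *\<^sub>R A z b) has_derivative
      (\<lambda>u. \<Sum>b\<in>Basis. (Y x \<bullet> b) *\<^sub>R A' u b + (Y' u \<bullet> b) *\<^sub>R A x b)) (at x)"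
    by (intro has_derivative_sum has_derivative_scaleR has_derivative_inner_left Y A)
  \<comment> \<open>Differentiating the basis expansion of \<open>A z w\<close> gives a second
    formula for its derivative; uniqueness then shows that \<open>A' u\<close> is determined
    linearly by its values on the basis.\<close>
  have "((\<lambda>z. A z w) has_derivative (\<lambda>u. \<Sum>b\<in>Basis. (w \<bullet> b) *\<^sub>R A' u b)) (at x)" for w
  proof (rule has_derivative_transform_within_open[OF _ S])
    show "((\<lambda>z. \<Sum>b\<in>Basis. (w \<bullet> b) *\<^sub>R A z b) has_derivative
        (\<lambda>u. \<Sum>b\<in>Basis. (w \<bullet> b) *\<^sub>R A' u b)) (at x)"
      by (intro has_derivative_sum has_derivative_scaleR_right A)
    show "(\<Sum>b\<in>Basis. (w \<bullet> b) *\<^sub>R A z b) = A z w" if "z \<in> S" for z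
      using expand[OF lin[OF that], of w] by simp
  qed
  from has_derivative_unique[OF A this]
  have A'exp: "(\<Sum>b\<in>Basis. (w \<bullet> b) *\<^sub>R A' u b) = A' u w" for u w
    by (metis (no_types, lifting))
  have "(\<Sum>b\<in>Basis. (Y x \<bullet> b) *\<^sub>R A' u b + (Y' u \<bullet> b) *\<^sub>R A x b) = A' u (Y x) + A x (Y' u)" for u
    using A'exp[of "Y x" u] expand[OF lin[OF S(2)], of "Y' u"] by (simp add: sum.distrib)
  with sum have "((\<lambda>z. \<Sum>b\<in>Basis. (Y z \<bullet> b) *\<^sub>R A z b) has_derivative
      (\<lambda>u. A' u (Y x) + A x (Y' u))) (at x)" by simp
  then show ?thesis
  proof (rule has_derivative_transform_within_open[OF _ S])
    show "(\<Sum>b\<in>Basis. (Y z \<bullet> b) *\<^sub>R A z b) = A z (Y z)" if "z \<in> S" for z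
      using expand[OF lin[OF that], of "Y z"] by simp
  qed
qed

text \<open>Against any vector orthogonal to \<open>P\<close> the function is constant on
  \<open>S\<close>, so the component of the derivative orthogonal to \<open>P\<close>
  vanishes.\<close>

lemma derivative_in_subspace:
  fixes F :: "'a::real_normed_vector \<Rightarrow> 'b::euclidean_space"
  assumes "open S" "x \<in> S" "subspace P" "\<And>y. y \<in> S \<Longrightarrow> F y - F x \<in> P"
    and F: "(F has_derivative F') (at x)"
  shows "F' u \<in> P"
proof -
  obtain y z where y: "y \<in> P" and z: "\<And>w. w \<in> P \<Longrightarrow> orthogonal z w" and u: "F' u = y + z"
    using orthogonal_subspace_decomp_exists[of P "F' u"] span_eq_iff[of P] assms(3) by metis
  have "((\<lambda>y. F y \<bullet> z) has_derivative (\<lambda>u. F' u \<bullet> z)) (at x)"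
    by (rule has_derivative_inner_left[OF F])
  moreover have "((\<lambda>y. F y \<bullet> z) has_derivative (\<lambda>u. 0)) (at x)"
  proof (rule has_derivative_transform_within_open[OF has_derivative_const assms(1,2)])
    show "F x \<bullet> z = F y \<bullet> z" if "y \<in> S" for y
      using z[OF assms(4)[OF that]] by (simp add: orthogonal_def inner_diff_right inner_commute)
  qed
  ultimately have "F' u \<bullet> z = 0"
    using has_derivative_unique by metis
  moreover have "y \<bullet> z = 0"
    using z[OF y] by (simp add: orthogonal_def inner_commute)
  ultimately have "z = 0" by (simp add: u inner_add_left)
  then show ?thesis using u y by simp
qed

lemma eventually_nhds_in_open:
  assumes "isCont f x" "open S" "f x \<in> S"
  shows "\<forall>\<^sub>F y in nhds x. f y \<in> S"
  using assms unfolding continuous_at_open eventually_nhds by blast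

lemma has_derivative_transform_nhds:
  assumes "(f has_derivative f') (at x)" "\<forall>\<^sub>F y in nhds x. f y = g y"
  shows "(g has_derivative f') (at x)"
  using assms has_derivative_transform_within_open[OF assms(1)] unfolding eventually_nhds by blast

lemma has_derivative_compose_Pair:
  assumes "(F has_derivative F') (at (f x, g x))" "(f has_derivative f') (at x)"
    "(g has_derivative g') (at x)"
  shows "((\<lambda>y. F (f y, g y)) has_derivative (\<lambda>u. F' (f' u, g' u))) (at x)"
  using diff_chain_at[OF has_derivative_Pair[OF assms(2,3)] assms(1)] by (simp add: o_def)

lemma has_derivative_ident_unique: "((\<lambda>y. y) has_derivative D) (at x) \<Longrightarrow> D u = u"
  using has_derivative_unique[OF _ has_derivative_ident] by metis

section \<open>Nilpotent metric Lie algebras\<close>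

text \<open>The sum is the Riesz representative of \<open>f\<close>; \<open>nab\<close>,
  \<open>D\<close> and the gradient \<open>F\<close> are all defined by such sums.\<close>

lemma sum_functional_inner:
  fixes f :: "'e::euclidean_space \<Rightarrow> real"
  assumes "linear f"
  shows "(\<Sum>b\<in>Basis. f b *\<^sub>R b) \<bullet> w = f w"
proof -
  have "f w = f (\<Sum>b\<in>Basis. (w \<bullet> b) *\<^sub>R b)"
    by (simp add: euclidean_representation)
  also have "\<dots> = (\<Sum>b\<in>Basis. (w \<bullet> b) * f b)"
    by (simp add: linear_sum[OF assms] linear_scale[OF assms])
  finally show ?thesis
    by (simp add: inner_sum_left inner_commute[of w] mult.commute)
qed

lemma trace_commute:
  fixes S T :: "'e::euclidean_space \<Rightarrow> 'e"
  assumes S: "linear S" and T: "linear T"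
  shows "(\<Sum>b\<in>Basis. S (T b) \<bullet> b) = (\<Sum>b\<in>Basis. T (S b) \<bullet> b)"
proof -
  have expand: "P (Q b) \<bullet> b = (\<Sum>c\<in>Basis. (Q b \<bullet> c) * (P c \<bullet> b))"
    if "linear P" for P Q :: "'e \<Rightarrow> 'e" and b
  proof -
    have "P (Q b) = P (\<Sum>c\<in>Basis. (Q b \<bullet> c) *\<^sub>R c)"
      by (simp add: euclidean_representation)
    then show ?thesis
      by (simp add: linear_sum[OF that] linear_scale[OF that] inner_sum_left)
  qed
  show ?thesis
    unfolding expand[OF S, of T] expand[OF T, of S]
    by (subst sum.swap) (simp add: mult.commute)
qed

text \<open>A \<open>B\<close>-orthonormal set of maximal size is a basis, since otherwise a
  Gram-Schmidt step enlarges it; \<open>L\<close> sends it to the standard basis. This reduces an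
  arbitrary inner product at the unit to the standard one.\<close>

lemma posdef_form_factor:
  fixes B :: "'e::euclidean_space \<Rightarrow> 'e \<Rightarrow> real"
  assumes B: "bilinear B" and sym: "\<And>u v. B u v = B v u" and pos: "\<And>u. u \<noteq> 0 \<Longrightarrow> B u u > 0"
  shows "\<exists>L :: 'e \<Rightarrow> 'e. linear L \<and> inj L \<and> (\<forall>u v. B u v = L u \<bullet> L v)"
proof -
  note B_simps = bilinear_ladd[OF B] bilinear_radd[OF B] bilinear_lmul[OF B] bilinear_rmul[OF B]
    bilinear_lsub[OF B] bilinear_rsub[OF B] bilinear_lzero[OF B] bilinear_rzero[OF B]
  have linB: "linear (\<lambda>u. B u v)" "linear (B u)" for u v
    using B by (auto simp: bilinear_def)
  define Q where "Q S \<longleftrightarrow> finite S \<and> (\<forall>s\<in>S. \<forall>t\<in>S. B s t = (if s = t then 1 else 0))" for S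
  have indep: "independent S" if "Q S" for S
  proof -
    have S: "finite S" "\<And>s t. s \<in> S \<Longrightarrow> t \<in> S \<Longrightarrow> B s t = (if s = t then 1 else 0)"
      using that by (auto simp: Q_def)
    have "c t = 0" if "(\<Sum>s\<in>S. c s *\<^sub>R s) = 0" "t \<in> S" for c t
    proof -
      have "B (\<Sum>s\<in>S. c s *\<^sub>R s) t = (\<Sum>s\<in>S. c s * B s t)"
        by (simp add: linear_sum[OF linB(1)] B_simps)
      also have "\<dots> = (\<Sum>s\<in>S. if s = t then c s else 0)"
        by (rule sum.cong) (use S that in auto)
      also have "\<dots> = c t" using S that by simp
      finally show ?thesis using that by (simp add: B_simps)
    qed
    then show ?thesis
      using independent_if_scalars_zero[OF S(1)] by blast
  qed
  have bound: "card S \<le> DIM('e)" if "Q S" for S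
    using independent_bound[OF indep[OF that]] by blast
  have "Q {}" by (simp add: Q_def)
  then obtain S where S: "Q S" "\<And>S'. Q S' \<Longrightarrow> card S' \<le> card S"
    using ex_has_greatest_nat[of Q "{}" card "Suc DIM('e)"] bound by (auto simp: less_Suc_eq_le)
  have Sfin: "finite S" and SB: "\<And>s t. s \<in> S \<Longrightarrow> t \<in> S \<Longrightarrow> B s t = (if s = t then 1 else 0)"
    using S(1) by (auto simp: Q_def)
  have repr: "u = (\<Sum>s\<in>S. B u s *\<^sub>R s)" for u
  proof (rule ccontr)
    assume neq: "u \<noteq> (\<Sum>s\<in>S. B u s *\<^sub>R s)"
    \<comment> \<open>The Gram-Schmidt remainder, which is \<open>B\<close>-orthogonal to
      \<open>S\<close>; once normalised it could be added to \<open>S\<close>.\<close>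
    define w where "w = u - (\<Sum>s\<in>S. B u s *\<^sub>R s)"
    have w0: "w \<noteq> 0" using neq by (simp add: w_def)
    have wS: "B w t = 0" if "t \<in> S" for t
    proof -
      have "B (\<Sum>s\<in>S. B u s *\<^sub>R s) t = (\<Sum>s\<in>S. B u s * B s t)"
        by (simp add: linear_sum[OF linB(1)] B_simps)
      also have "\<dots> = (\<Sum>s\<in>S. if s = t then B u s else 0)"
        by (rule sum.cong) (use SB that in auto)
      also have "\<dots> = B u t" using Sfin that by simp
      finally show ?thesis by (simp add: w_def B_simps)
    qed
    define n where "n = (1 / sqrt (B w w)) *\<^sub>R w"
    have nn: "B n n = 1"
      using pos[OF w0] by (simp add: n_def B_simps)
    have nS: "B n t = 0" "B t n = 0" if "t \<in> S" for t
      using wS[OF that] sym[of t w] by (simp_all add: n_def B_simps)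
    have "n \<notin> S" using nS nn by force
    moreover have "Q (insert n S)"
      unfolding Q_def using Sfin SB nn nS \<open>n \<notin> S\<close> by auto
    ultimately show False using S(2)[of "insert n S"] Sfin by simp
  qed
  have "card S = DIM('e)"
  proof -
    have "u \<in> span S" for u
      by (subst repr[of u]) (intro span_sum span_scale span_base)
    then have "span S = UNIV" by auto
    then have "dim S = DIM('e)" by (metis dim_span dim_UNIV)
    then show ?thesis using indep[OF S(1)] dim_eq_card_independent by metis
  qed
  then obtain b where b: "bij_betw b S (Basis :: 'e set)"
    using bij_betw_iff_card[OF Sfin finite_Basis] by blast
  define L where "L u = (\<Sum>s\<in>S. B u s *\<^sub>R b s)" for u
  have b_inner: "b s \<bullet> b t = (if s = t then 1 else 0)" if "s \<in> S" "t \<in> S" for s t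
    using that bij_betwE[OF b] inj_on_eq_iff[OF bij_betw_imp_inj_on[OF b]]
    by (simp add: inner_Basis)
  have L_inner: "L u \<bullet> b t = B u t" if "t \<in> S" for u t
  proof -
    have "L u \<bullet> b t = (\<Sum>s\<in>S. B u s * (b s \<bullet> b t))" by (simp add: L_def inner_sum_left)
    also have "\<dots> = (\<Sum>s\<in>S. if s = t then B u s else 0)"
      by (rule sum.cong) (use b_inner that in auto)
    finally show ?thesis using Sfin that by simp
  qed
  have LB: "B u v = L u \<bullet> L v" for u v
  proof -
    have "B u v = B u (\<Sum>s\<in>S. B v s *\<^sub>R s)" using repr[of v] by simp
    also have "\<dots> = (\<Sum>s\<in>S. B v s * B u s)" by (simp add: linear_sum[OF linB(2)] B_simps)
    also have "\<dots> = (\<Sum>s\<in>S. B v s * (L u \<bullet> b s))"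
      by (rule sum.cong) (simp_all add: L_inner)
    also have "\<dots> = L u \<bullet> L v" by (simp add: L_def[of v] inner_sum_right)
    finally show ?thesis .
  qed
  have "linear L"
    by (rule linearI)
      (simp_all add: L_def B_simps scaleR_add_left sum.distrib scaleR_sum_right)
  moreover have "inj L"
    using linear_injective_0[OF \<open>linear L\<close>] LB pos by (metis inner_zero_left less_irrefl)
  ultimately show ?thesis using LB by blast
qed

section \<open>Levi-Civita connection and Ricci curvature of a metric Lie algebra\<close>

text \<open>The inner product is the one of the Euclidean space \<open>'e\<close>; other inner
  products are moved to it by \<open>posdef_form_factor\<close>.\<close>

locale metric_lie_algebra =
  fixes br :: "'e::euclidean_space \<Rightarrow> 'e \<Rightarrow> 'e"
  assumes br_bilinear: "bilinear br"
    and br_antisym: "br u v = - br v u"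
begin

text \<open>The Koszul formula on left invariant fields, for which the derivatives of the inner
  products vanish.\<close>

definition nab :: "'e \<Rightarrow> 'e \<Rightarrow> 'e" where
  "nab u v = (\<Sum>b\<in>Basis. ((br u v \<bullet> b - br u b \<bullet> v - br v b \<bullet> u) / 2) *\<^sub>R b)"

definition Rm :: "'e \<Rightarrow> 'e \<Rightarrow> 'e \<Rightarrow> 'e" where
  "Rm u v w = nab u (nab v w) - nab v (nab u w) - nab (br u v) w"

definition Ric :: "'e \<Rightarrow> 'e \<Rightarrow> real" where
  "Ric v w = (\<Sum>b\<in>Basis. Rm b v w \<bullet> b)"

lemmas br_simps = bilinear_ladd[OF br_bilinear] bilinear_radd[OF br_bilinear]
  bilinear_lmul[OF br_bilinear] bilinear_rmul[OF br_bilinear]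
  bilinear_lsub[OF br_bilinear] bilinear_rsub[OF br_bilinear]
  bilinear_lneg[OF br_bilinear] bilinear_rneg[OF br_bilinear]
  bilinear_lzero[OF br_bilinear] bilinear_rzero[OF br_bilinear]

lemma linear_br: "linear (br u)" "linear (\<lambda>u. br u v)"
  using br_bilinear by (auto simp: bilinear_def)

lemma br_self: "br u u = 0"
proof (rule euclidean_eqI)
  fix b :: 'e
  have "br u u \<bullet> b = - br u u \<bullet> b"
    using arg_cong[OF br_antisym[of u u], of "\<lambda>v. v \<bullet> b"] .
  then show "br u u \<bullet> b = 0 \<bullet> b" by simp
qed

lemma nab_inner: "nab u v \<bullet> w = (br u v \<bullet> w - br u w \<bullet> v - br v w \<bullet> u) / 2"
proof -
  have "linear (\<lambda>w. (br u v \<bullet> w - br u w \<bullet> v - br v w \<bullet> u) / 2)"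
    by (rule linearI)
      (simp_all add: br_simps inner_add_left inner_add_right algebra_simps add_divide_distrib
        diff_divide_distrib)
  then show ?thesis
    unfolding nab_def by (rule sum_functional_inner)
qed

lemma nab_bilinear: "bilinear nab"
  unfolding bilinear_def
proof (intro conjI allI linearI)
  fix u v w :: 'e and r :: real
  show "nab u (v + w) = nab u v + nab u w" "nab (v + w) u = nab v u + nab w u"
    by (rule euclidean_eqI, simp add: nab_inner br_simps inner_add_left inner_add_right field_simps)+
  show "nab u (r *\<^sub>R v) = r *\<^sub>R nab u v" "nab (r *\<^sub>R v) u = r *\<^sub>R nab v u"
    by (rule euclidean_eqI, simp add: nab_inner br_simps right_diff_distrib)+
qed

lemmas nab_simps = bilinear_ladd[OF nab_bilinear] bilinear_radd[OF nab_bilinear]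
  bilinear_lmul[OF nab_bilinear] bilinear_rmul[OF nab_bilinear]
  bilinear_lsub[OF nab_bilinear] bilinear_rsub[OF nab_bilinear]
  bilinear_lneg[OF nab_bilinear] bilinear_rneg[OF nab_bilinear]
  bilinear_lzero[OF nab_bilinear] bilinear_rzero[OF nab_bilinear]

lemma nab_skew: "nab u v \<bullet> w = - (v \<bullet> nab u w)"
proof -
  have "nab u v \<bullet> w + nab u w \<bullet> v = 0"
    unfolding nab_inner using br_antisym[of v w] by (simp add: inner_simps field_simps)
  then show ?thesis by (simp add: inner_commute)
qed

lemma nab_torsion_free: "nab u v - nab v u = br u v"
proof (rule euclidean_eqI)
  fix b :: 'e
  show "(nab u v - nab v u) \<bullet> b = br u v \<bullet> b"
    unfolding inner_diff_left nab_inner using br_antisym[of v u]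
    by (simp add: inner_simps field_simps)
qed

lemma linear_nab: "linear (nab u)" "linear (\<lambda>u. nab u v)"
  using nab_bilinear by (auto simp: bilinear_def)

lemma Rm_linear1: "linear (\<lambda>u. Rm u v w)"
  unfolding Rm_def
  by (intro linear_compose_sub
      linear_compose[OF linear_nab(2)[of w] linear_nab(1)[of v], unfolded o_def]
      linear_compose[OF linear_br(2)[of v] linear_nab(2)[of w], unfolded o_def] linear_nab)

lemma Rm_linear2: "linear (\<lambda>v. Rm u v w)"
  unfolding Rm_def
  by (intro linear_compose_sub linear_nab
      linear_compose[OF linear_nab(2)[of w] linear_nab(1)[of u], unfolded o_def]
      linear_compose[OF linear_br(1)[of u] linear_nab(2)[of w], unfolded o_def])

lemma Rm_linear3: "linear (\<lambda>w. Rm u v w)"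
  unfolding Rm_def
  by (intro linear_compose_sub linear_nab
      linear_compose[OF linear_nab(1)[of u] linear_nab(1)[of v], unfolded o_def]
      linear_compose[OF linear_nab(1)[of v] linear_nab(1)[of u], unfolded o_def])

lemma Ric_linear1: "linear (\<lambda>v. Ric v w)"
  by (rule linearI) (simp_all add: Ric_def linear_add[OF Rm_linear2] linear_scale[OF Rm_linear2]
    inner_simps sum.distrib sum_distrib_left)

lemma Ric_linear2: "linear (\<lambda>w. Ric v w)"
  by (rule linearI) (simp_all add: Ric_def linear_add[OF Rm_linear3] linear_scale[OF Rm_linear3]
    inner_simps sum.distrib sum_distrib_left)

text \<open>In \<open>Rm b u u\<close> the term with \<open>nab u u\<close> drops out and
  \<open>br b u\<close> splits by torsion-freeness. Two of the remaining traces are tr(ST) and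
  tr(TS) for the maps \<open>nab u\<close> and \<open>b \<mapsto> nab b u\<close>, and
  cancel.\<close>

lemma Ric_geodesic:
  assumes "nab u u = 0"
  shows "Ric u u = - (\<Sum>b\<in>Basis. nab (nab b u) u \<bullet> b)"
proof -
  have "Rm b u u = - nab u (nab b u) - nab (nab b u) u + nab (nab u b) u" for b
    unfolding Rm_def nab_torsion_free[of b u, symmetric] by (simp add: assms nab_simps)
  then have "Ric u u = - (\<Sum>b\<in>Basis. nab u (nab b u) \<bullet> b)
      - (\<Sum>b\<in>Basis. nab (nab b u) u \<bullet> b) + (\<Sum>b\<in>Basis. nab (nab u b) u \<bullet> b)"
    unfolding Ric_def
    by (simp add: inner_diff_left inner_add_left sum.distrib sum_subtractf sum_negf)
  moreover have "(\<Sum>b\<in>Basis. nab u (nab b u) \<bullet> b) = (\<Sum>b\<in>Basis. nab (nab u b) u \<bullet> b)"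
    using trace_commute[OF linear_nab(1)[of u] linear_nab(2)[of u]] by simp
  ultimately show ?thesis by simp
qed

text \<open>The constant \<open>c\<close> is the squared length of the component \<open>z\<close> of
  \<open>u\<close> orthogonal to \<open>P\<close>: the component in \<open>P\<close> contributes
  nothing to the Ricci value, and on \<open>z\<close> the equation for \<open>F\<close> forces
  \<open>Ric u z = l * (u \<bullet> z)\<close>.\<close>

lemma Ric_geodesic_shape:
  assumes P: "subspace P" and nabP: "\<And>w. w \<in> P \<Longrightarrow> nab u w \<in> P"
    and RicP: "\<And>w. w \<in> P \<Longrightarrow> Ric u w = 0"
    and F: "(\<Sum>b\<in>Basis. (l * (u \<bullet> b) - Ric u b) *\<^sub>R b) - nab u F \<in> P"
    and geodesic: "nab u u = 0"
  shows "\<exists>c\<ge>0. Ric u u = l * c"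
proof -
  obtain y z where y: "y \<in> P" and z: "\<And>w. w \<in> P \<Longrightarrow> orthogonal z w" and u: "u = y + z"
    using orthogonal_subspace_decomp_exists[of P u] span_eq_iff[of P] P by metis
  have zP: "z \<bullet> w = 0" if "w \<in> P" for w
    using z[OF that] by (simp add: orthogonal_def)
  have "nab u z = - nab u y"
    using geodesic linear_add[OF linear_nab(1), of u y z] u by (simp add: add_eq_0_iff)
  then have "nab u z \<in> P"
    using nabP[OF y] P by (simp add: subspace_neg)
  \<comment> \<open>Skewness moves one \<open>nab u\<close> across; \<open>nab u (nab u z)\<close>
    lies in \<open>P\<close> by invariance and \<open>z\<close> is orthogonal to
    \<open>P\<close>.\<close>
  then have "nab u z \<bullet> nab u z = 0"
    by (simp add: nab_skew[of u z] zP nabP)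
  then have uz: "nab u z = 0" by simp
  have "((\<Sum>b\<in>Basis. (l * (u \<bullet> b) - Ric u b) *\<^sub>R b) - nab u F) \<bullet> z = 0"
    using zP[OF F] by (simp add: inner_commute)
  moreover have "linear (\<lambda>w. l * (u \<bullet> w) - Ric u w)"
    by (rule linearI) (simp_all add: inner_add_right linear_add[OF Ric_linear2]
        linear_scale[OF Ric_linear2] algebra_simps)
  ultimately have "l * (u \<bullet> z) = Ric u z"
    by (simp add: inner_diff_left sum_functional_inner nab_skew[of u F] uz)
  moreover have "Ric u u = Ric u y + Ric u z"
    using linear_add[OF Ric_linear2, of u y z] u by simp
  moreover have "u \<bullet> z = z \<bullet> z"
    using zP[OF y] by (simp add: u inner_add_left inner_commute[of y z])
  ultimately show ?thesis
    using RicP[OF y] by (intro exI[of _ "z \<bullet> z"]) simp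
qed

end

section \<open>Signs of Ricci curvature in the nonabelian nilpotent case\<close>

text \<open>By \<open>Ric_eq\<close> the Ricci values of all vectors with \<open>nab u u = 0\<close>
  have the sign of \<open>l\<close> or vanish. Central vectors inside the commutator ideal exclude
  \<open>l \<le> 0\<close>, and vectors orthogonal to that ideal exclude
  \<open>l > 0\<close>.\<close>

lemma nilpotent_metric_lie_algebra_Ric:
  fixes br :: "'e::euclidean_space \<Rightarrow> 'e \<Rightarrow> 'e" and W :: "nat \<Rightarrow> 'e set"
  assumes "metric_lie_algebra br"
    and W0: "W 0 = UNIV"
    and WS: "\<And>j. W (Suc j) = span {br u v | u v. v \<in> W j}"
    and nilpotent: "W k = {0}"
    and nonabelian: "br u0 v0 \<noteq> 0"
    and Ric_eq: "\<And>u. metric_lie_algebra.nab br u u = 0 \<Longrightarrow>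
      \<exists>c\<ge>0. metric_lie_algebra.Ric br u u = l * c"
  shows False
proof -
  interpret metric_lie_algebra br by fact
  have sub: "subspace (W j)" for j
    by (cases j) (auto simp: W0 WS)
  have step: "br u v \<in> W (Suc j)" if "v \<in> W j" for u v j
    using that by (auto simp: WS intro!: span_base)
  have W1: "br u v \<in> W 1" for u v
    using step[of v 0 u] by (simp add: W0)
  show False
  proof (cases "l \<le> 0")
    case True
    have "W 1 \<noteq> {0}"
      using W1[of u0 v0] nonabelian by auto
    \<comment> \<open>The first trivial term of the series. A nonzero bracket forces it to have
      index at least 2, so the last nonzero term \<open>W (Suc i)\<close> is contained in the
      commutator ideal \<open>W 1\<close>.\<close>
    moreover define j where "j = (LEAST j. W j = {0})"
    have j: "W j = {0}" unfolding j_def by (rule LeastI, rule nilpotent)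
    have jmin: "W i \<noteq> {0}" if "i < j" for i
      using not_less_Least[of i "\<lambda>j. W j = {0}"] that unfolding j_def by auto
    have "W 0 \<noteq> {0}" using nonabelian W0
      by (metis UNIV_I singletonD)
    ultimately have "j \<noteq> 0" "j \<noteq> 1" using j by auto
    then obtain i where i: "j = Suc (Suc i)"
      by (metis One_nat_def not0_implies_Suc)
    obtain z where z: "z \<in> W (Suc i)" "z \<noteq> 0"
      using jmin[of "Suc i"] i subspace_0[OF sub, of "Suc i"] by auto
    have central: "br u z = 0" for u
      using step[OF z(1), of u] j i by simp
    have central': "br z u = 0" for u
      using central br_antisym[of z u] by simp
    have zz: "nab z z = 0"
      by (rule euclidean_eqI) (simp add: nab_inner central')
    have nabz: "nab b z \<bullet> w = - (br b w \<bullet> z) / 2" for b w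
      by (simp add: nab_inner central central')
    have skew: "nab b z \<bullet> w = - (nab w z \<bullet> b)" for b w
      unfolding nabz using br_antisym[of b w] by (simp add: inner_simps)
    \<comment> \<open>For a skew endomorphism \<open>b \<mapsto> nab b z\<close> the negative trace
      of its square is a sum of squared lengths.\<close>
    have "nab (nab b z) z \<bullet> b = - (norm (nab b z))\<^sup>2" for b
      using skew[of "nab b z" b] by (simp add: power2_norm_eq_inner)
    then have "Ric z z = (\<Sum>b\<in>Basis. (norm (nab b z))\<^sup>2)"
      unfolding Ric_geodesic[OF zz] by (simp add: sum_negf)
    moreover obtain c where "c \<ge> 0" "Ric z z = l * c" using Ric_eq[OF zz] by blast
    ultimately have "(\<Sum>b\<in>Basis. (norm (nab b z))\<^sup>2) \<le> 0"
      using True by (metis mult_nonpos_nonneg)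
    then have "(\<Sum>b\<in>Basis. (norm (nab b z))\<^sup>2) = 0"
      by (simp add: sum_nonneg order_antisym)
    then have nab0: "nab b z = 0" if "b \<in> Basis" for b
      using that by (simp add: sum_nonneg_eq_0_iff)
    have "nab u z = 0" for u
      using linear_eq_0_on_span[OF linear_nab(2) nab0, of Basis] by (simp add: span_Basis)
    \<comment> \<open>Now \<open>z\<close> is orthogonal to every bracket although it lies in their
      span, so it is zero.\<close>
    then have perp: "z \<bullet> br b w = 0" for b w
      using nabz[of b w] by (simp add: inner_commute)
    have "W (Suc i) \<subseteq> W 1"
      unfolding WS[of i] One_nat_def WS[of 0] by (rule span_mono) (auto simp: W0)
    then have "z \<in> span {br u v |u v. True}"
      using z(1) by (auto simp: WS[of 0] W0)
    then have "orthogonal z z"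
      by (rule orthogonal_to_span) (use perp in \<open>auto simp: orthogonal_def\<close>)
    then show False using z(2) by (simp add: orthogonal_self)
  next
    case False
    have centre: "br x y = 0" if perp: "\<And>u v. x \<bullet> br u v = 0" for x y
    proof -
      have xbr: "br u v \<bullet> x = 0" for u v
        using perp[of u v] by (simp add: inner_commute)
      have xx: "nab x x = 0"
        using perp by (intro euclidean_eqI[where 'a='e]) (simp add: nab_inner xbr br_self)
      have nabx: "nab b x \<bullet> w = (br b x \<bullet> w - br x w \<bullet> b) / 2" for b w
        by (simp add: nab_inner xbr)
      have sym: "nab b x \<bullet> w = nab w x \<bullet> b" for b w
        unfolding nabx using br_antisym[of b x] br_antisym[of w x] by (simp add: inner_simps)
      have "nab (nab b x) x \<bullet> b = (norm (nab b x))\<^sup>2" for b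
        using sym[of "nab b x" b] by (simp add: power2_norm_eq_inner)
      then have "Ric x x = - (\<Sum>b\<in>Basis. (norm (nab b x))\<^sup>2)"
        unfolding Ric_geodesic[OF xx] by simp
      moreover obtain c where "c \<ge> 0" "Ric x x = l * c" using Ric_eq[OF xx] by blast
      ultimately have "(\<Sum>b\<in>Basis. (norm (nab b x))\<^sup>2) \<le> 0"
        using False by (smt (verit) mult_nonneg_nonneg)
      then have "(\<Sum>b\<in>Basis. (norm (nab b x))\<^sup>2) = 0"
        by (simp add: sum_nonneg order_antisym)
      then have nab0: "nab b x = 0" if "b \<in> Basis" for b
        using that by (simp add: sum_nonneg_eq_0_iff)
      have "nab u x = 0" for u
        using linear_eq_0_on_span[OF linear_nab(2) nab0, of Basis] by (simp add: span_Basis)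
      \<comment> \<open>When \<open>nab b x\<close> vanishes, its formula \<open>nabx\<close> says
        precisely that \<open>br x\<close> is skew.\<close>
      then have ad_skew: "br x w \<bullet> b = - (w \<bullet> br x b)" for b w
        using nabx[of b w] br_antisym[of b x] by (simp add: inner_simps inner_commute)
      \<comment> \<open>Induction from the trivial term \<open>W k\<close> up to \<open>W 0\<close>:
        \<open>br x\<close> maps each term into the next, where it already vanishes, and a skew map
        with \<open>br x (br x v) = 0\<close> satisfies \<open>br x v = 0\<close>.\<close>
      have "\<forall>v\<in>W (k - i). br x v = 0" if "i \<le> k" for i
        using that
      proof (induction i)
        case 0
        then show ?case using nilpotent by (simp add: br_simps)
      next
        case (Suc i)
        then have eq: "k - i = Suc (k - Suc i)" by simp
        show ?case
        proof
          fix v assume "v \<in> W (k - Suc i)"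
          then have "br x v \<in> W (k - i)" unfolding eq by (rule step)
          then have "br x (br x v) = 0" using Suc by simp
          then have "br x v \<bullet> br x v = 0" by (simp add: ad_skew)
          then show "br x v = 0" by simp
        qed
      qed
      from this[of k] show ?thesis by (simp add: W0)
    qed
    \<comment> \<open>Removing from \<open>v\<close> its central component orthogonal to the
      brackets leaves the bracket unchanged and puts \<open>v\<close> into their span, hence into
      \<open>W j\<close>; bracketing gains one more step. So brackets lie in every term, including
      the trivial one.\<close>
    have W1j: "br u v \<in> W j" for u v j
    proof (induction j arbitrary: u v)
      case 0
      then show ?case by (simp add: W0)
    next
      case (Suc j)
      define S where "S = span {br u v |u v. True}"
      obtain y z where yz: "y \<in> S" "\<And>w. w \<in> S \<Longrightarrow> orthogonal z w" "v = y + z"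
        using orthogonal_subspace_decomp_exists[of "{br u v |u v. True}" v] unfolding S_def by blast
      have "br z u = 0" for u
        by (rule centre) (use yz(2) in \<open>auto simp: orthogonal_def S_def intro: span_base\<close>)
      then have "br u z = 0" using br_antisym[of u z] by simp
      then have "br u v = br u y" by (simp add: yz(3) br_simps)
      moreover have "S \<subseteq> W j"
        unfolding S_def by (rule span_minimal) (use Suc sub in auto)
      ultimately show ?case using step[of y j u] yz(1) by auto
    qed
    show False using W1j[of u0 v0 k] nilpotent nonabelian by simp
  qed
qed

text \<open>The series generated by iterated brackets lies inside every such filtration
  \<open>E\<close>, so it becomes trivial as soon as \<open>E\<close> does. The group commutators
  below yield a filtration of this kind.\<close>

lemma nilpotent_metric_lie_algebra_Ric_filtration:
  fixes br :: "'e::euclidean_space \<Rightarrow> 'e \<Rightarrow> 'e" and E :: "nat \<Rightarrow> 'e set"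
  assumes "metric_lie_algebra br"
    and "\<And>j. subspace (E j)"
    and "E 0 = UNIV"
    and "\<And>u v j. v \<in> E j \<Longrightarrow> br u v \<in> E (Suc j)"
    and "E k = {0}"
    and "br u0 v0 \<noteq> 0"
    and "\<And>u. metric_lie_algebra.nab br u u = 0 \<Longrightarrow>
      \<exists>c\<ge>0. metric_lie_algebra.Ric br u u = l * c"
  shows False
proof -
  define W where "W = rec_nat UNIV (\<lambda>_ W. span {br u v | u v. v \<in> W})"
  have W: "W 0 = UNIV" "\<And>j. W (Suc j) = span {br u v | u v. v \<in> W j}"
    by (simp_all add: W_def)
  have sub: "W j \<subseteq> E j" for j
  proof (induction j)
    case 0
    then show ?case by (simp add: assms(3))
  next
    case (Suc j)
    then show ?case
      unfolding W by (intro span_minimal assms(2)) (use assms(4) in blast)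
  qed
  have "0 \<in> W k" by (cases k) (auto simp: W span_zero)
  then have "W k = {0}" using sub[of k] assms(5) by auto
  then show False
    using nilpotent_metric_lie_algebra_Ric[OF assms(1) W _ assms(6,7)] by blast
qed

section \<open>Left invariant coframes and gradient solitons\<close>

text \<open>\<open>A x\<close> reads a coordinate vector at \<open>x\<close> in an orthonormal left
  invariant frame, and \<open>X x\<close> is the way back. The Maurer-Cartan equation ties this
  coframe to the bracket.\<close>

locale left_invariant_coframe = metric_lie_algebra br
  for br :: "'e::euclidean_space \<Rightarrow> 'e \<Rightarrow> 'e" +
  fixes S :: "'e set" and A X :: "'e \<Rightarrow> 'e \<Rightarrow> 'e"
  assumes S_open: "open S"
    and A_linear: "x \<in> S \<Longrightarrow> linear (A x)"
    and A_smooth: "Ck_on 2 (\<lambda>z. A z w) S"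
    and A_X: "x \<in> S \<Longrightarrow> A x (X x v) = v"
    and X_differentiable: "x \<in> S \<Longrightarrow> (\<lambda>z. X z v) differentiable (at x)"
    and maurer_cartan: "x \<in> S \<Longrightarrow>
      dir_deriv (\<lambda>z. A z v) x u - dir_deriv (\<lambda>z. A z u) x v = - br (A x u) (A x v)"
begin

abbreviation dA :: "'e \<Rightarrow> 'e \<Rightarrow> 'e \<Rightarrow> 'e" where
  "dA x u v \<equiv> dir_deriv (\<lambda>z. A z v) x u"

lemma A_inj: "x \<in> S \<Longrightarrow> inj (A x)"
  using A_linear A_X by (metis linear_surjective_imp_injective surjI)

lemma X_A: "x \<in> S \<Longrightarrow> X x (A x v) = v"
  using A_inj A_X by (metis injD)

lemma X_linear:
  assumes "x \<in> S" shows "linear (X x)"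
proof (rule linearI)
  fix u v r
  show "X x (u + v) = X x u + X x v" "X x (r *\<^sub>R u) = r *\<^sub>R X x u"
    by (rule injD[OF A_inj[OF assms]],
        simp add: A_X[OF assms] linear_add[OF A_linear[OF assms]]
          linear_scale[OF A_linear[OF assms]])+
qed

lemma A_has_derivative: "x \<in> S \<Longrightarrow> ((\<lambda>z. A z v) has_derivative (\<lambda>u. dA x u v)) (at x)"
  using A_smooth[of v] by (intro dir_deriv_works) (simp add: numeral_2_eq_2)

lemma dA_differentiable: "x \<in> S \<Longrightarrow> (\<lambda>z. dA z u v) differentiable (at x)"
  using A_smooth[of v] by (simp add: numeral_2_eq_2)

lemma A_apply:
  "x \<in> S \<Longrightarrow> (Y has_derivative Y') (at x) \<Longrightarrow>
    ((\<lambda>z. A z (Y z)) has_derivative (\<lambda>u. dA x u (Y x) + A x (Y' u))) (at x)"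
  by (rule has_derivative_apply[OF S_open _ A_linear A_has_derivative])

lemma X_apply_differentiable:
  assumes "x \<in> S" "Y differentiable (at x)"
  shows "(\<lambda>z. X z (Y z)) differentiable (at x)"
  by (rule differentiableI)
    (rule has_derivative_apply[OF S_open assms(1) X_linear
        dir_deriv_works[OF X_differentiable[OF assms(1)]] dir_deriv_works[OF assms(2)]])

lemma nab_has_derivative:
  assumes "(f has_derivative f') (at x)" "(g has_derivative g') (at x)"
  shows "((\<lambda>z. nab (f z) (g z)) has_derivative (\<lambda>u. nab (f x) (g' u) + nab (f' u) (g x))) (at x)"
  using bounded_bilinear.FDERIV[OF _ assms] nab_bilinear bilinear_conv_bounded_bilinear by blast

text \<open>Leibniz rule: the constant coordinate field \<open>v\<close> has frame components
  \<open>A x v\<close>, so its covariant derivative is the derivative of these components plus the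
  algebraic term \<open>nab\<close>.\<close>

definition Gam :: "'e \<Rightarrow> 'e \<Rightarrow> 'e \<Rightarrow> 'e" where
  "Gam x u v = X x (nab (A x u) (A x v) + dA x u v)"

lemma A_Gam: "x \<in> S \<Longrightarrow> A x (Gam x u v) = nab (A x u) (A x v) + dA x u v"
  by (simp add: Gam_def A_X)

lemma Gam_differentiable:
  assumes "x \<in> S"
  shows "(\<lambda>z. Gam z u v) differentiable (at x)"
  unfolding Gam_def
  using nab_has_derivative[OF A_has_derivative[OF assms] A_has_derivative[OF assms]]
  by (intro X_apply_differentiable[OF assms] differentiable_add dA_differentiable[OF assms])
    (rule differentiableI)

context
  fixes h :: "'e \<Rightarrow> 'e \<Rightarrow> 'e \<Rightarrow> real"
  assumes h: "\<And>x u v. x \<in> S \<Longrightarrow> h x u v = A x u \<bullet> A x v"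
begin

lemma dir_deriv_metric:
  assumes "x \<in> S"
  shows "dir_deriv (\<lambda>z. h z v w) x u = A x v \<bullet> dA x u w + dA x u v \<bullet> A x w"
proof -
  have "((\<lambda>z. h z v w) has_derivative (\<lambda>u. A x v \<bullet> dA x u w + dA x u v \<bullet> A x w)) (at x)"
    by (rule has_derivative_transform_within_open[OF has_derivative_inner[OF
          A_has_derivative[OF assms] A_has_derivative[OF assms]] S_open assms])
      (simp add: h)
  then show ?thesis by (rule dir_deriv_apply)
qed

text \<open>Swapping the arguments of a derivative of \<open>A\<close> costs a bracket by
  Maurer-Cartan. In the coordinate Koszul formula the swapped derivatives cancel and the brackets
  form the Koszul formula of \<open>nab\<close>; testing on \<open>X x b\<close> gives
  uniqueness.\<close>

lemma christoffel_eq: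
  assumes x: "x \<in> S"
  shows "christoffel h x u v = Gam x u v"
  unfolding christoffel_def
proof (rule the_equality)
  have mc: "dA x a b = dA x b a - br (A x a) (A x b)" for a b
    using maurer_cartan[OF x, of b a] by (simp add: algebra_simps)
  show *: "\<forall>w. 2 * h x (Gam x u v) w = dir_deriv (\<lambda>z. h z v w) x u +
      dir_deriv (\<lambda>z. h z u w) x v - dir_deriv (\<lambda>z. h z u v) x w"
  proof
    fix w
    have "A x v \<bullet> dA x u w = A x v \<bullet> dA x w u - br (A x u) (A x w) \<bullet> A x v"
      unfolding mc[where a=u and b=w] by (simp add: inner_diff_right inner_commute)
    moreover have "A x u \<bullet> dA x v w = A x u \<bullet> dA x w v - br (A x v) (A x w) \<bullet> A x u"
      unfolding mc[where a=v and b=w] by (simp add: inner_diff_right inner_commute)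
    moreover have "dA x u v \<bullet> A x w = dA x v u \<bullet> A x w - br (A x u) (A x v) \<bullet> A x w"
      unfolding mc[where a=u and b=v] by (simp add: inner_diff_left)
    ultimately show "2 * h x (Gam x u v) w = dir_deriv (\<lambda>z. h z v w) x u +
      dir_deriv (\<lambda>z. h z u w) x v - dir_deriv (\<lambda>z. h z u v) x w"
      unfolding dir_deriv_metric[OF x] h[OF x] A_Gam[OF x] inner_add_left nab_inner
      by (simp add: inner_commute field_simps)
  qed
  fix y assume y: "\<forall>w. 2 * h x y w = dir_deriv (\<lambda>z. h z v w) x u +
      dir_deriv (\<lambda>z. h z u w) x v - dir_deriv (\<lambda>z. h z u v) x w"
  have "2 * h x y w = 2 * h x (Gam x u v) w" for w
    by (rule trans[OF spec[OF y, of w] spec[OF *, of w, symmetric]])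
  then have eq: "h x y w = h x (Gam x u v) w" for w
    by simp
  have "A x y \<bullet> b = A x (Gam x u v) \<bullet> b" for b
    using eq[of "X x b"] by (simp only: h[OF x] A_X[OF x])
  then have "A x y = A x (Gam x u v)"
    by (rule euclidean_eqI)
  then show "y = Gam x u v" by (rule injD[OF A_inj[OF x]])
qed

text \<open>The second derivatives of \<open>A\<close> cancel by symmetry, and the antisymmetric
  part of its first derivatives supplies the term \<open>nab (br u v) w\<close> of the algebraic
  curvature.\<close>

lemma A_riemann:
  assumes x: "x \<in> S"
  shows "A x (riemann_coord h x u v w) = Rm (A x u) (A x v) (A x w)"
proof -
  define ddA where "ddA u v = dir_deriv (\<lambda>z. dA z v w) x u" for u v
  have half: "A x (dir_deriv (\<lambda>z. christoffel h z v w) x u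
        + christoffel h x u (christoffel h x v w))
      = ddA u v + nab (A x v) (dA x u w) + nab (dA x u v) (A x w)
        + nab (A x u) (nab (A x v) (A x w)) + nab (A x u) (dA x v w)" for u v
  proof -
    define G where "G = dir_deriv (\<lambda>z. Gam z v w) x"
    have G: "((\<lambda>z. Gam z v w) has_derivative G) (at x)"
      unfolding G_def by (rule dir_deriv_works[OF Gam_differentiable[OF x]])
    have "((\<lambda>z. christoffel h z v w) has_derivative G) (at x)"
      by (rule has_derivative_transform_within_open[OF G S_open x]) (simp add: christoffel_eq)
    then have dchr: "dir_deriv (\<lambda>z. christoffel h z v w) x u = G u"
      by (rule dir_deriv_apply)
    \<comment> \<open>The same function is differentiated by the product rule and through
      \<open>A_Gam\<close>. Equating the results gives \<open>A x (G u)\<close> without a formula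
      for the derivative of \<open>X\<close>.\<close>
    have 1: "((\<lambda>z. A z (Gam z v w)) has_derivative
        (\<lambda>u. dA x u (Gam x v w) + A x (G u))) (at x)"
      by (rule A_apply[OF x G])
    have "((\<lambda>z. nab (A z v) (A z w) + dA z v w) has_derivative
        (\<lambda>u. nab (A x v) (dA x u w) + nab (dA x u v) (A x w) + ddA u v)) (at x)"
      unfolding ddA_def
      by (intro has_derivative_add nab_has_derivative A_has_derivative x
          dir_deriv_works dA_differentiable)
    then have 2: "((\<lambda>z. A z (Gam z v w)) has_derivative
        (\<lambda>u. nab (A x v) (dA x u w) + nab (dA x u v) (A x w) + ddA u v)) (at x)"
      by (rule has_derivative_transform_within_open[OF _ S_open x]) (simp add: A_Gam)
    have "dA x u (Gam x v w) + A x (G u)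
      = nab (A x v) (dA x u w) + nab (dA x u v) (A x w) + ddA u v"
      using fun_cong[OF has_derivative_unique[OF 1 2]] .
    then show ?thesis
      unfolding dchr christoffel_eq[OF x] linear_add[OF A_linear[OF x]] A_Gam[OF x, of u]
      by (simp add: A_Gam[OF x] nab_simps algebra_simps)
  qed
  have sym: "ddA u v = ddA v u"
    unfolding ddA_def
    using Ck_on_symmetric[OF S_open x, of 0 "\<lambda>z. A z w" v u] A_smooth[of w]
    by (simp add: numeral_2_eq_2)
  have "br (A x u) (A x v) = dA x v u - dA x u v"
    using maurer_cartan[OF x, of v u] by (simp add: algebra_simps)
  then have "nab (br (A x u) (A x v)) (A x w) = nab (dA x v u) (A x w) - nab (dA x u v) (A x w)"
    by (simp add: nab_simps)
  then show ?thesis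
    unfolding riemann_coord_def linear_diff[OF A_linear[OF x]] half Rm_def sym
    by (simp add: algebra_simps)
qed

text \<open>\<open>A x\<close> conjugates the coordinate curvature endomorphism to the algebraic
  one, and the trace is invariant under conjugation.\<close>

lemma ricci_coord_eq:
  assumes x: "x \<in> S"
  shows "ricci_coord h x v w = Ric (A x v) (A x w)"
proof -
  have "riemann_coord h x b v w = X x (Rm (A x b) (A x v) (A x w))" for b
    using X_A[OF x, of "riemann_coord h x b v w"] by (simp add: A_riemann[OF x])
  then have "ricci_coord h x v w = (\<Sum>b\<in>Basis. (X x (Rm (A x b) (A x v) (A x w))) \<bullet> b)"
    by (simp add: ricci_coord_def)
  also have "\<dots> = (\<Sum>b\<in>Basis. A x (X x (Rm b (A x v) (A x w))) \<bullet> b)"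
    using trace_commute[OF linear_compose[OF Rm_linear1 X_linear[OF x]] A_linear[OF x],
        of "A x v" "A x w"] by (simp add: o_def)
  finally show ?thesis by (simp add: A_X[OF x] Ric_def)
qed

section \<open>The gradient of the potential in the frame\<close>

context
  fixes \<phi> :: "'e \<Rightarrow> real" and l :: real
  assumes \<phi>: "Ck_on 2 \<phi> S"
    and soliton: "\<And>x u v. x \<in> S \<Longrightarrow>
      ricci_coord h x u v + hessian_coord h \<phi> x u v = l * h x u v"
begin

definition F :: "'e \<Rightarrow> 'e" where
  "F x = (\<Sum>b\<in>Basis. dir_deriv \<phi> x (X x b) *\<^sub>R b)"

definition D :: "'e \<Rightarrow> 'e" where
  "D u = (\<Sum>b\<in>Basis. (l * (u \<bullet> b) - Ric u b) *\<^sub>R b)"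

lemma D_inner: "D u \<bullet> v = l * (u \<bullet> v) - Ric u v"
  unfolding D_def
  by (rule sum_functional_inner, rule linearI)
    (simp_all add: inner_add_right linear_add[OF Ric_linear2] linear_scale[OF Ric_linear2]
      algebra_simps)

lemma D_linear: "linear D"
proof (rule linearI)
  fix u v :: 'e and r :: real
  show "D (u + v) = D u + D v" "D (r *\<^sub>R u) = r *\<^sub>R D u"
    by (rule euclidean_eqI, simp add: D_inner inner_add_left linear_add[OF Ric_linear1]
        linear_scale[OF Ric_linear1] algebra_simps)+
qed

lemma \<phi>_has_derivative: "x \<in> S \<Longrightarrow> (\<phi> has_derivative dir_deriv \<phi> x) (at x)"
  using \<phi> by (intro dir_deriv_works) (simp add: numeral_2_eq_2)

lemma dir_deriv_\<phi>:
  assumes "x \<in> S" shows "dir_deriv \<phi> x u = F x \<bullet> A x u"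
  using sum_functional_inner[OF linear_compose[OF X_linear[OF assms]
        has_derivative_linear[OF \<phi>_has_derivative[OF assms]]], of "A x u"]
  by (simp add: F_def X_A[OF assms])

lemma F_differentiable:
  assumes x: "x \<in> S" shows "F differentiable (at x)"
proof -
  have "(\<lambda>z. dir_deriv \<phi> z (X z b)) differentiable (at x)" for b
  proof (rule differentiableI, rule has_derivative_apply[OF S_open x,
        where A = "dir_deriv \<phi>" and Y = "\<lambda>z. X z b"])
    show "linear (dir_deriv \<phi> z)" if "z \<in> S" for z
      using has_derivative_linear[OF \<phi>_has_derivative[OF that]] .
    show "((\<lambda>z. dir_deriv \<phi> z w) has_derivative (\<lambda>u. dir_deriv (\<lambda>z. dir_deriv \<phi> z w) x u)) (at x)"
      for w
      using \<phi> x by (intro dir_deriv_works) (simp add: numeral_2_eq_2)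
    show "((\<lambda>z. X z b) has_derivative dir_deriv (\<lambda>z. X z b) x) (at x)"
      by (rule dir_deriv_works[OF X_differentiable[OF x]])
  qed
  then show ?thesis
    unfolding F_def by (intro differentiable_sum differentiable_scaleR) auto
qed

text \<open>Differentiating \<open>F z \<bullet> A z v\<close> for a constant \<open>v\<close> gives
  the second derivative of \<phi>. Its term with \<open>dA\<close> cancels against the one in
  \<open>Gam\<close>, so the Hessian involves only the derivative of \<open>F\<close> and
  \<open>nab\<close>; the soliton equation does the rest.\<close>

lemma dir_deriv_F:
  assumes x: "x \<in> S" shows "dir_deriv F x u = D (A x u) - nab (A x u) (F x)"
proof (rule euclidean_eqI)
  fix b :: 'e
  define v where "v = X x b"
  have v: "A x v = b" by (simp add: v_def A_X[OF x])
  have "((\<lambda>z. F z \<bullet> A z v) has_derivative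
      (\<lambda>u. F x \<bullet> dA x u v + dir_deriv F x u \<bullet> A x v)) (at x)"
    by (intro has_derivative_inner dir_deriv_works F_differentiable A_has_derivative x)
  then have "((\<lambda>z. dir_deriv \<phi> z v) has_derivative
      (\<lambda>u. F x \<bullet> dA x u v + dir_deriv F x u \<bullet> A x v)) (at x)"
    by (rule has_derivative_transform_within_open[OF _ S_open x]) (simp add: dir_deriv_\<phi>)
  then have "dir_deriv (\<lambda>z. dir_deriv \<phi> z v) x u = F x \<bullet> dA x u v + dir_deriv F x u \<bullet> A x v"
    by (rule dir_deriv_apply)
  then have "hessian_coord h \<phi> x u v = dir_deriv F x u \<bullet> b - F x \<bullet> nab (A x u) b"
    unfolding hessian_coord_def christoffel_eq[OF x] dir_deriv_\<phi>[OF x] A_Gam[OF x] v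
    by (simp add: inner_add_right)
  then show "dir_deriv F x u \<bullet> b = (D (A x u) - nab (A x u) (F x)) \<bullet> b"
    using soliton[OF x, of u v]
    unfolding ricci_coord_eq[OF x] h[OF x] v inner_diff_left D_inner nab_skew[of "A x u" "F x"]
    by simp
qed

text \<open>Equality of the mixed second derivatives of \<open>F\<close>, each computed by
  substituting \<open>dir_deriv_F\<close> twice. The right-hand side does not involve the point
  \<open>x\<close>, which is what is used later.\<close>

lemma Rm_F:
  assumes x: "x \<in> S"
  shows "Rm u v (F x) = nab u (D v) - nab v (D u) - D (br u v)"
proof -
  define a b where "a = X x u" and "b = X x v"
  have ab: "A x a = u" "A x b = v" by (simp_all add: a_def b_def A_X[OF x])
  have "((\<lambda>z. D (A z p) - nab (A z p) (F z)) has_derivative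
      (\<lambda>q. D (dA x q p) - (nab (A x p) (dir_deriv F x q) + nab (dA x q p) (F x)))) (at x)" for p
    by (intro has_derivative_diff nab_has_derivative A_has_derivative x dir_deriv_works
        F_differentiable bounded_linear.has_derivative[OF linear_conv_bounded_linear[THEN iffD1, OF D_linear]])
  then have D2: "((\<lambda>z. dir_deriv F z p) has_derivative
      (\<lambda>q. D (dA x q p) - (nab (A x p) (dir_deriv F x q) + nab (dA x q p) (F x)))) (at x)" for p
    by (rule has_derivative_transform_within_open[OF _ S_open x]) (simp add: dir_deriv_F)
  have "dir_deriv (\<lambda>z. dir_deriv F z a) x b = dir_deriv (\<lambda>z. dir_deriv F z b) x a"
    by (rule second_derivative_symmetric[OF S_open x F_differentiable])
      (use D2 differentiableI in blast)+
  then have eq: "D (dA x b a) - (nab u (D v - nab v (F x)) + nab (dA x b a) (F x))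
      = D (dA x a b) - (nab v (D u - nab u (F x)) + nab (dA x a b) (F x))"
    unfolding dir_deriv_eq[OF D2] dir_deriv_F[OF x] ab .
  have br: "br u v = dA x b a - dA x a b"
    using maurer_cartan[OF x, of b a] by (simp add: ab algebra_simps)
  show ?thesis
    using eq unfolding Rm_def br linear_diff[OF D_linear] nab_simps
    by (simp add: algebra_simps)
qed

lemma Ric_geodesic_coframe:
  assumes "x0 \<in> S" "nab u u = 0"
  shows "\<exists>c\<ge>0. Ric u u = l * c"
proof -
  define P where "P = span {F x - F y | x y. x \<in> S \<and> y \<in> S}"
  have P: "subspace P" by (simp add: P_def)
  have diffP: "F x - F y \<in> P" if "x \<in> S" "y \<in> S" for x y
    unfolding P_def using that by (intro span_base) blast
  have DF: "D v - nab v (F x) \<in> P" if x: "x \<in> S" for v x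
  proof -
    have "dir_deriv F x (X x v) \<in> P"
      by (rule derivative_in_subspace[OF S_open x P diffP[OF _ x]
            dir_deriv_works[OF F_differentiable[OF x]]])
    then show ?thesis by (simp add: dir_deriv_F[OF x] A_X[OF x])
  qed
  have nabP: "nab v w \<in> P" if "w \<in> P" for v w
  proof -
    \<comment> \<open>The terms \<open>D v\<close> cancel in the difference of \<open>DF\<close> at
      the two points.\<close>
    have "nab v (F x - F y) \<in> P" if "x \<in> S" "y \<in> S" for x y
      using subspace_diff[OF P DF[OF that(2), of v] DF[OF that(1), of v]]
      by (simp add: nab_simps)
    then have gen: "{F x - F y | x y. x \<in> S \<and> y \<in> S} \<subseteq> nab v -` P"
      by auto
    have "P \<subseteq> nab v -` P"
      using span_minimal[OF gen linear_subspace_vimage[OF linear_nab(1) P]]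
      by (simp add: P_def)
    then show ?thesis using that by auto
  qed
  \<comment> \<open>By \<open>Rm_F\<close> the curvature takes the same value on \<open>F x\<close>
    at all points, so it kills the differences that span \<open>P\<close>.\<close>
  have RmP: "Rm v v' w = 0" if "w \<in> P" for v v' w
  proof (rule linear_eq_0_on_span[OF Rm_linear3, of "{F x - F y | x y. x \<in> S \<and> y \<in> S}"])
    show "w \<in> span {F x - F y |x y. x \<in> S \<and> y \<in> S}" using that by (simp add: P_def)
    show "Rm v v' w = 0" if "w \<in> {F x - F y |x y. x \<in> S \<and> y \<in> S}" for w
      using that by (auto simp: linear_diff[OF Rm_linear3] Rm_F)
  qed
  show ?thesis
    by (rule Ric_geodesic_shape[OF P nabP _ DF[OF assms(1), unfolded D_def] assms(2)])
      (simp_all add: Ric_def RmP)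
qed

end

end

end

section \<open>Lie groups in a chart around the unit\<close>

context smooth_manifold
begin

lemma chart_subset: "d \<in> A \<Longrightarrow> fst d \<subseteq> topspace T"
  using chart_open openin_subset by blast

lemma chart_inj: "d \<in> A \<Longrightarrow> inj_on (snd d) (fst d)"
  using chart_homeo[of d] chart_subset[of d]
  by (auto dest!: homeomorphic_imp_injective_map simp: Int_absorb1)

lemma cinv_chart: "d \<in> A \<Longrightarrow> p \<in> fst d \<Longrightarrow> cinv d (snd d p) = p"
  using chart_inj by simp

lemma chart_cinv: "x \<in> cimage d \<Longrightarrow> snd d (cinv d x) = x" "x \<in> cimage d \<Longrightarrow> cinv d x \<in> fst d"
  by (simp_all add: f_inv_into_f inv_into_into)

lemma continuous_cinv:
  assumes "d \<in> A" shows "continuous_map (top_of_set (cimage d)) T (cinv d)"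
proof -
  obtain k where k: "homeomorphic_maps (subtopology T (fst d)) (top_of_set (cimage d)) (snd d) k"
    using chart_homeo[OF assms] homeomorphic_map_maps by blast
  then have "continuous_map (top_of_set (cimage d)) T k"
    unfolding homeomorphic_maps_def by (metis continuous_map_into_fulltopology)
  moreover have "k x = cinv d x" if "x \<in> topspace (top_of_set (cimage d))" for x
  proof -
    have "x \<in> cimage d" using that by simp
    then obtain p where p: "p \<in> fst d" "x = snd d p" by auto
    then have "k x = p"
      using k chart_subset[OF assms] unfolding homeomorphic_maps_def by auto
    then show ?thesis using cinv_chart[OF assms p(1)] p(2) by simp
  qed
  ultimately show ?thesis by (rule continuous_map_eq)
qed

lemma open_chart_preimage:
  assumes "d \<in> A" "open W" "continuous_map (top_of_set W) T F"
  shows "open {z \<in> W. F z \<in> fst d}"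
proof -
  have "openin (top_of_set W) {z \<in> topspace (top_of_set W). F z \<in> fst d}"
    by (rule openin_continuous_map_preimage[OF assms(3) chart_open[OF assms(1)]])
  then show ?thesis using assms(2) openin_open_trans by auto
qed

end

context lie_group
begin

text \<open>\<open>mul c1 c2 d\<close> is the multiplication read in the charts \<open>c1\<close>, \<open>c2\<close> and \<open>d\<close>, meaningful on
  \<open>mul_dom c1 c2 d\<close>.\<close>

definition mul ::
    "('a, 'e) chart \<Rightarrow> ('a, 'e) chart \<Rightarrow> ('a, 'e) chart \<Rightarrow> 'e \<times> 'e \<Rightarrow> 'e" where
  "mul c1 c2 d z = snd d (cinv c1 (fst z) \<otimes> cinv c2 (snd z))"

definition mul_dom ::
    "('a, 'e) chart \<Rightarrow> ('a, 'e) chart \<Rightarrow> ('a, 'e) chart \<Rightarrow> ('e \<times> 'e) set" where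
  "mul_dom c1 c2 d =
    {z \<in> cimage c1 \<times> cimage c2. cinv c1 (fst z) \<otimes> cinv c2 (snd z) \<in> fst d}"

lemma open_mul_dom:
  assumes "c1 \<in> A" "c2 \<in> A" "d \<in> A"
  shows "open (mul_dom c1 c2 d)"
proof -
  have "continuous_map (prod_topology (top_of_set (cimage c1)) (top_of_set (cimage c2)))
      (prod_topology T T) (\<lambda>z. (cinv c1 (fst z), cinv c2 (snd z)))"
    using continuous_cinv[OF assms(1)] continuous_cinv[OF assms(2)]
    by (intro continuous_map_pairedI continuous_map_compose[OF continuous_map_fst, unfolded o_def]
        continuous_map_compose[OF continuous_map_snd, unfolded o_def])
  moreover have "continuous_map (prod_topology T T) T (\<lambda>(x, y). x \<otimes> y)"
    using smooth_mult by (simp add: smooth_map_def)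
  ultimately have "continuous_map (top_of_set (cimage c1 \<times> cimage c2)) T
      (\<lambda>z. cinv c1 (fst z) \<otimes> cinv c2 (snd z))"
    using continuous_map_compose by (fastforce simp: o_def prod_topology_subtopology_eu)
  from open_chart_preimage[OF assms(3) _ this] show ?thesis
    unfolding mul_dom_def using chart_image_open assms by (simp add: open_Times)
qed

text \<open>Smoothness of the multiplication is given in product charts; on its image the inverse of
  the product chart \<open>P\<close> is the pair of the inverses.\<close>

lemma Ck_on_mul:
  assumes c: "c1 \<in> A" "c2 \<in> A" "d \<in> A"
  shows "Ck_on k (mul c1 c2 d) (mul_dom c1 c2 d)"
proof -
  define P where "P = (fst c1 \<times> fst c2, \<lambda>(p, q). (snd c1 p, snd c2 q))"
  have "P \<in> product_atlas A A"
    using c by (force simp: P_def product_atlas_def)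
  then have smooth: "smooth_on (snd d \<circ> (\<lambda>(x, y). x \<otimes> y) \<circ> cinv P)
      (snd P ` {p \<in> fst P. (\<lambda>(x, y). x \<otimes> y) p \<in> fst d})"
    using smooth_mult c by (simp add: smooth_map_def)
  have inj: "inj_on (snd P) (fst P)"
    using chart_inj[OF c(1)] chart_inj[OF c(2)] by (auto simp: P_def inj_on_def)
  have cinvP: "cinv P (x, y) = (cinv c1 x, cinv c2 y)" if "x \<in> cimage c1" "y \<in> cimage c2" for x y
  proof (rule inv_into_f_eq[OF inj])
    show "(cinv c1 x, cinv c2 y) \<in> fst P"
      using that chart_cinv(2)[of x c1] chart_cinv(2)[of y c2] by (simp add: P_def)
    show "snd P (cinv c1 x, cinv c2 y) = (x, y)"
      using that chart_cinv(1)[of x c1] chart_cinv(1)[of y c2] by (simp add: P_def)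
  qed
  have dom: "mul_dom c1 c2 d \<subseteq> snd P ` {p \<in> fst P. (\<lambda>(x, y). x \<otimes> y) p \<in> fst d}"
  proof
    fix z assume z: "z \<in> mul_dom c1 c2 d"
    then have m: "fst z \<in> cimage c1" "snd z \<in> cimage c2"
      "cinv c1 (fst z) \<otimes> cinv c2 (snd z) \<in> fst d"
      by (auto simp: mul_dom_def)
    have "z = snd P (cinv c1 (fst z), cinv c2 (snd z))"
      using chart_cinv(1)[OF m(1)] chart_cinv(1)[OF m(2)] by (simp add: P_def)
    moreover have "(cinv c1 (fst z), cinv c2 (snd z)) \<in> {p \<in> fst P. (\<lambda>(x, y). x \<otimes> y) p \<in> fst d}"
      using m chart_cinv(2)[OF m(1)] chart_cinv(2)[OF m(2)] by (simp add: P_def)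
    ultimately show "z \<in> snd P ` {p \<in> fst P. (\<lambda>(x, y). x \<otimes> y) p \<in> fst d}" by (rule image_eqI)
  qed
  have "Ck_on k (snd d \<circ> (\<lambda>(x, y). x \<otimes> y) \<circ> cinv P) (mul_dom c1 c2 d)"
    using smooth dom by (auto simp: smooth_on_def intro: Ck_on_subset)
  then show ?thesis
    by (rule Ck_on_cong[OF open_mul_dom[OF c], rotated])
      (auto simp: mul_dom_def mul_def cinvP)
qed

end

section \<open>Multiplication and inversion near the unit\<close>

text \<open>Through the chart \<open>c\<close> the model space \<open>'e\<close> serves as the
  tangent space at the unit, hence as the Lie algebra.\<close>

locale lie_group_unit_chart = lie_group G T A
  for G :: "('a, 'm) monoid_scheme" (structure)
    and T :: "'a topology" and A :: "('a, 'e::euclidean_space) chart set" +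
  fixes c :: "('a, 'e) chart"
  assumes c: "c \<in> A" and one_in: "\<one> \<in> fst c"
begin

abbreviation e :: 'e where "e \<equiv> snd c \<one>"
abbreviation pt :: "'e \<Rightarrow> 'a" where "pt \<equiv> cinv c"
abbreviation \<mu> :: "'e \<times> 'e \<Rightarrow> 'e" where "\<mu> \<equiv> mul c c c"
abbreviation \<Omega> :: "('e \<times> 'e) set" where "\<Omega> \<equiv> mul_dom c c c"
abbreviation d\<mu> :: "'e \<times> 'e \<Rightarrow> 'e \<times> 'e \<Rightarrow> 'e" where "d\<mu> \<equiv> dir_deriv \<mu>"

definition \<iota> :: "'e \<Rightarrow> 'e" where "\<iota> x = snd c (inv (pt x))"
text \<open>At points whose inverse also lies in the chart, translation by the inverse, and so
  \<open>theta\<close>, can be read in \<open>c\<close> alone.\<close>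

definition S :: "'e set" where "S = {x \<in> cimage c. inv (pt x) \<in> fst c}"

text \<open>\<open>theta x\<close> is the left Maurer-Cartan form and \<open>frame x u\<close> the value at \<open>x\<close> of the left
  invariant field with value \<open>u\<close> at the unit.\<close>

definition theta :: "'e \<Rightarrow> 'e \<Rightarrow> 'e" where "theta x u = d\<mu> (\<iota> x, x) (0, u)"
definition frame :: "'e \<Rightarrow> 'e \<Rightarrow> 'e" where "frame x u = d\<mu> (x, e) (0, u)"
abbreviation dtheta :: "'e \<Rightarrow> 'e \<Rightarrow> 'e \<Rightarrow> 'e" where
  "dtheta x u v \<equiv> dir_deriv (\<lambda>z. theta z v) x u"
text \<open>Minus the exterior derivative of \<open>theta\<close> at the unit, as the Maurer-Cartan
  equation demands; \<open>lie_bracket_unit\<close> identifies it with the bracket of left invariant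
  fields.\<close>

definition br :: "'e \<Rightarrow> 'e \<Rightarrow> 'e" where "br u v = dtheta e v u - dtheta e u v"

lemma chart_carrier: "d \<in> A \<Longrightarrow> p \<in> fst d \<Longrightarrow> p \<in> carrier G"
  using chart_subset topspace_eq by blast

lemma pt_snd: "p \<in> fst c \<Longrightarrow> pt (snd c p) = p"
  by (rule cinv_chart[OF c])

lemma pt_in: "x \<in> cimage c \<Longrightarrow> pt x \<in> fst c"
  by (rule chart_cinv(2))

lemma pt_carrier: "x \<in> cimage c \<Longrightarrow> pt x \<in> carrier G"
  using chart_carrier[OF c pt_in] .

lemma snd_pt: "x \<in> cimage c \<Longrightarrow> snd c (pt x) = x"
  by (rule chart_cinv(1))

lemma e_in: "e \<in> cimage c" using one_in by blast

lemma pt_e: "pt e = \<one>" by (rule pt_snd[OF one_in])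

lemma open_cimage: "open (cimage c)" by (rule chart_image_open[OF c])

lemma S_cimage: "x \<in> S \<Longrightarrow> x \<in> cimage c" by (simp add: S_def)

lemma pt_S: "x \<in> S \<Longrightarrow> pt x \<in> carrier G" using pt_carrier S_cimage by blast

lemma e_S: "e \<in> S" using one_in e_in by (simp add: S_def pt_e)

lemma \<iota>_in: "x \<in> S \<Longrightarrow> \<iota> x \<in> cimage c" by (auto simp: S_def \<iota>_def)

lemma pt_\<iota>: "x \<in> S \<Longrightarrow> pt (\<iota> x) = inv (pt x)" by (simp add: S_def \<iota>_def pt_snd)

lemma \<iota>_e: "\<iota> e = e" by (simp add: \<iota>_def pt_e)

lemma \<mu>_eq: "\<mu> (x, y) = snd c (pt x \<otimes> pt y)" by (simp add: mul_def)

lemma \<Omega>_iff: "(x, y) \<in> \<Omega> \<longleftrightarrow> x \<in> cimage c \<and> y \<in> cimage c \<and> pt x \<otimes> pt y \<in> fst c"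
  by (auto simp: mul_dom_def)

lemma pt_\<mu>: "(x, y) \<in> \<Omega> \<Longrightarrow> pt (\<mu> (x, y)) = pt x \<otimes> pt y"
  by (simp add: \<Omega>_iff \<mu>_eq pt_snd)

lemma open_\<Omega>: "open \<Omega>" by (rule open_mul_dom[OF c c c])

lemma Ck_on_\<mu>: "Ck_on k \<mu> \<Omega>" by (rule Ck_on_mul[OF c c c])

lemma \<mu>_has_derivative: "z \<in> \<Omega> \<Longrightarrow> (\<mu> has_derivative d\<mu> z) (at z)"
  using Ck_on_Suc_D(1)[OF Ck_on_\<mu>] .

lemma Ck_on_d\<mu>: "Ck_on k (\<lambda>z. d\<mu> z w) \<Omega>"
  using Ck_on_Suc_D(2)[OF Ck_on_\<mu>] .

lemma d\<mu>_has_derivative: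
  "z \<in> \<Omega> \<Longrightarrow> ((\<lambda>z. d\<mu> z w) has_derivative (\<lambda>v. dir_deriv (\<lambda>z. d\<mu> z w) z v)) (at z)"
  using Ck_on_Suc_D(1)[OF Ck_on_d\<mu>] .

lemma d\<mu>_symmetric:
  "z \<in> \<Omega> \<Longrightarrow> dir_deriv (\<lambda>z. d\<mu> z u) z v = dir_deriv (\<lambda>z. d\<mu> z v) z u"
  by (rule Ck_on_symmetric[OF open_\<Omega> _ Ck_on_\<mu>])

lemma d\<mu>_linear: "z \<in> \<Omega> \<Longrightarrow> linear (d\<mu> z)"
  using has_derivative_linear[OF \<mu>_has_derivative] .

lemma d\<mu>_split: "z \<in> \<Omega> \<Longrightarrow> d\<mu> z (u, v) = d\<mu> z (u, 0) + d\<mu> z (0, v)"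
  using linear_add[OF d\<mu>_linear, of z "(u, 0)" "(0, v)"] by simp

lemma left_\<Omega>: "x \<in> cimage c \<Longrightarrow> (x, e) \<in> \<Omega>"
  using pt_in[of x] pt_carrier[of x] e_in by (simp add: \<Omega>_iff pt_e)

lemma right_\<Omega>: "x \<in> cimage c \<Longrightarrow> (e, x) \<in> \<Omega>"
  using pt_in[of x] pt_carrier[of x] e_in by (simp add: \<Omega>_iff pt_e)

lemma inv_\<Omega>: "x \<in> S \<Longrightarrow> (\<iota> x, x) \<in> \<Omega>" "x \<in> S \<Longrightarrow> (x, \<iota> x) \<in> \<Omega>"
  using \<iota>_in[of x] S_cimage[of x] pt_S[of x] one_in by (simp_all add: \<Omega>_iff pt_\<iota>)

lemma \<mu>_unit: "x \<in> cimage c \<Longrightarrow> \<mu> (x, e) = x" "x \<in> cimage c \<Longrightarrow> \<mu> (e, x) = x"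
  using pt_carrier[of x] snd_pt[of x] by (simp_all add: \<mu>_eq pt_e)

lemma \<mu>_inv: "x \<in> S \<Longrightarrow> \<mu> (\<iota> x, x) = e" "x \<in> S \<Longrightarrow> \<mu> (x, \<iota> x) = e"
  using pt_S[of x] by (simp_all add: \<mu>_eq pt_\<iota>)

lemma near_cimage: "x \<in> cimage c \<Longrightarrow> \<forall>\<^sub>F y in nhds x. y \<in> cimage c"
  using open_cimage by (auto simp: eventually_nhds)

lemma d\<mu>_unit:
  assumes "x \<in> cimage c" shows "d\<mu> (x, e) (u, 0) = u" "d\<mu> (e, x) (0, u) = u"
proof -
  have "((\<lambda>y. \<mu> (y, e)) has_derivative (\<lambda>u. d\<mu> (x, e) (u, 0))) (at x)"
    by (rule has_derivative_compose_Pair[OF \<mu>_has_derivative[OF left_\<Omega>[OF assms]]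
          has_derivative_ident has_derivative_const])
  then have "((\<lambda>y. y) has_derivative (\<lambda>u. d\<mu> (x, e) (u, 0))) (at x)"
    by (rule has_derivative_transform_nhds)
      (rule eventually_mono[OF near_cimage[OF assms] \<mu>_unit(1)])
  then show "d\<mu> (x, e) (u, 0) = u"
    by (rule has_derivative_ident_unique)
  have "((\<lambda>y. \<mu> (e, y)) has_derivative (\<lambda>u. d\<mu> (e, x) (0, u))) (at x)"
    by (rule has_derivative_compose_Pair[OF \<mu>_has_derivative[OF right_\<Omega>[OF assms]]
          has_derivative_const has_derivative_ident])
  then have "((\<lambda>y. y) has_derivative (\<lambda>u. d\<mu> (e, x) (0, u))) (at x)"
    by (rule has_derivative_transform_nhds)
      (rule eventually_mono[OF near_cimage[OF assms] \<mu>_unit(2)])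
  then show "d\<mu> (e, x) (0, u) = u"
    by (rule has_derivative_ident_unique)
qed

lemma open_S: "open S"
proof -
  have "continuous_map T T (\<lambda>x. inv x)"
    using smooth_inv by (simp add: smooth_map_def)
  from continuous_map_compose[OF continuous_cinv[OF c] this]
  show ?thesis
    unfolding S_def by (intro open_chart_preimage[OF c open_cimage]) (simp add: o_def)
qed

lemma Ck_on_\<iota>: "Ck_on k \<iota> S"
proof -
  have "smooth_on (snd c \<circ> (\<lambda>x. inv x) \<circ> cinv c) (snd c ` {p \<in> fst c. inv p \<in> fst c})"
    using smooth_inv c by (simp add: smooth_map_def)
  moreover have "S \<subseteq> snd c ` {p \<in> fst c. inv p \<in> fst c}"
  proof
    fix x assume x: "x \<in> S"
    then have "x = snd c (pt x)" using snd_pt[OF S_cimage[OF x]] by simp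
    moreover have "pt x \<in> {p \<in> fst c. inv p \<in> fst c}"
      using x pt_in[OF S_cimage[OF x]] by (simp add: S_def)
    ultimately show "x \<in> snd c ` {p \<in> fst c. inv p \<in> fst c}" by (rule image_eqI)
  qed
  ultimately have "Ck_on k (snd c \<circ> (\<lambda>x. inv x) \<circ> cinv c) S"
    by (auto simp: smooth_on_def intro: Ck_on_subset)
  moreover have "snd c \<circ> (\<lambda>x. inv x) \<circ> cinv c = \<iota>" by (auto simp: \<iota>_def)
  ultimately show ?thesis by simp
qed

lemma \<iota>_has_derivative: "x \<in> S \<Longrightarrow> (\<iota> has_derivative dir_deriv \<iota> x) (at x)"
  using Ck_on_Suc_D(1)[OF Ck_on_\<iota>] .

text \<open>Differentiate the constant map \<open>y \<mapsto> \<mu> (y, \<iota> y)\<close> at the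
  unit.\<close>

lemma d\<iota>_e: "dir_deriv \<iota> e u = - u"
proof -
  have "((\<lambda>y. \<mu> (y, \<iota> y)) has_derivative (\<lambda>u. d\<mu> (e, e) (u, dir_deriv \<iota> e u))) (at e)"
    using \<mu>_has_derivative[OF left_\<Omega>[OF e_in]]
    by (intro has_derivative_compose_Pair has_derivative_ident \<iota>_has_derivative e_S)
      (simp add: \<iota>_e)
  then have "((\<lambda>y. e) has_derivative (\<lambda>u. d\<mu> (e, e) (u, dir_deriv \<iota> e u))) (at e)"
    by (rule has_derivative_transform_within_open[OF _ open_S e_S]) (rule \<mu>_inv(2))
  from fun_cong[OF has_derivative_unique[OF this has_derivative_const], of u]
  show ?thesis
    unfolding d\<mu>_split[OF left_\<Omega>[OF e_in], of u "dir_deriv \<iota> e u"] d\<mu>_unit[OF e_in]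
    by (simp add: add_eq_0_iff)
qed

section \<open>The Maurer-Cartan form and the bracket\<close>

lemma theta_linear: "x \<in> S \<Longrightarrow> linear (theta x)"
  by (rule linearI)
    (simp_all add: theta_def linear_add[OF d\<mu>_linear[OF inv_\<Omega>(1)], symmetric]
      linear_scale[OF d\<mu>_linear[OF inv_\<Omega>(1)], symmetric])

lemma theta_e: "theta e u = u"
  by (simp add: theta_def \<iota>_e d\<mu>_unit[OF e_in])

lemma Ck_on_theta: "Ck_on k (\<lambda>x. theta x w) S"
  unfolding theta_def
  by (rule Ck_on_compose[OF open_S Ck_on_d\<mu> Ck_on_Pair[OF open_S Ck_on_\<iota>
        Ck_on_bounded_linear[OF open_S bounded_linear_ident]]])
    (use inv_\<Omega>(1) in auto)

lemma Ck_on_frame: "Ck_on k (\<lambda>x. frame x w) S"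
  unfolding frame_def
  by (rule Ck_on_compose[OF open_S Ck_on_d\<mu> Ck_on_Pair[OF open_S
        Ck_on_bounded_linear[OF open_S bounded_linear_ident] Ck_on_const[OF open_S]]])
    (use left_\<Omega> S_cimage in auto)

lemma theta_has_derivative:
  "x \<in> S \<Longrightarrow> ((\<lambda>z. theta z v) has_derivative (\<lambda>u. dtheta x u v)) (at x)"
  using Ck_on_Suc_D(1)[OF Ck_on_theta] .

lemma \<mu>_left_has_derivative:
  assumes "(s, x) \<in> \<Omega>"
  shows "((\<lambda>y. \<mu> (s, y)) has_derivative (\<lambda>u. d\<mu> (s, x) (0, u))) (at x)"
  by (rule has_derivative_compose_Pair[OF \<mu>_has_derivative[OF assms] has_derivative_const
        has_derivative_ident])

lemma near_left:
  assumes "(s, x) \<in> \<Omega>" shows "\<forall>\<^sub>F y in nhds x. (s, y) \<in> \<Omega>"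
  by (rule eventually_nhds_in_open[where f = "\<lambda>y. (s, y)", OF _ open_\<Omega> assms])
    (intro continuous_intros)

lemma near_\<mu>:
  assumes "(s, x) \<in> \<Omega>" "open U" "\<mu> (s, x) \<in> U" shows "\<forall>\<^sub>F y in nhds x. \<mu> (s, y) \<in> U"
  by (rule eventually_nhds_in_open[where f = "\<lambda>y. \<mu> (s, y)",
        OF has_derivative_continuous[OF \<mu>_left_has_derivative[OF assms(1)]] assms(2,3)])

text \<open>Translation by \<open>x\<close> followed by translation by its inverse is the identity
  near the unit.\<close>

lemma theta_frame:
  assumes x: "x \<in> S" shows "theta x (frame x u) = u"
proof -
  have \<Omega>: "(x, e) \<in> \<Omega>" "(\<iota> x, x) \<in> \<Omega>"
    using left_\<Omega>[OF S_cimage[OF x]] inv_\<Omega>(1)[OF x] by auto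
  have \<mu>xe: "\<mu> (x, e) = x" by (rule \<mu>_unit(1)[OF S_cimage[OF x]])
  have "((\<lambda>y. \<mu> (\<iota> x, \<mu> (x, y))) has_derivative (\<lambda>u. d\<mu> (\<iota> x, x) (0, d\<mu> (x, e) (0, u)))) (at e)"
    by (rule has_derivative_compose_Pair[OF _ has_derivative_const \<mu>_left_has_derivative[OF \<Omega>(1)]])
      (simp add: \<mu>xe \<mu>_has_derivative[OF \<Omega>(2)])
  moreover have "\<forall>\<^sub>F y in nhds e. \<mu> (\<iota> x, \<mu> (x, y)) = y"
    using near_left[OF \<Omega>(1)]
  proof eventually_elim
    case (elim y)
    then have y: "y \<in> cimage c" by (simp add: \<Omega>_iff)
    then show ?case
      using elim x pt_S[OF x] pt_carrier[OF y]
      by (simp add: \<mu>_eq[of "\<iota> x"] pt_\<mu> pt_\<iota> m_assoc[symmetric] snd_pt)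
  qed
  ultimately have "((\<lambda>y. y) has_derivative (\<lambda>u. theta x (frame x u))) (at e)"
    unfolding theta_def frame_def by (rule has_derivative_transform_nhds)
  from fun_cong[OF has_derivative_unique[OF this has_derivative_ident], of u]
  show ?thesis .
qed

text \<open>The chain rule for the identity (sy)^-1 (sz) = y^-1 z, as functions of z near y.\<close>

lemma theta_left_invariant:
  assumes s: "(s, y) \<in> \<Omega>" and y: "y \<in> S" and sy: "\<mu> (s, y) \<in> S"
  shows "theta (\<mu> (s, y)) (d\<mu> (s, y) (0, u)) = theta y u"
proof -
  let ?t = "\<iota> (\<mu> (s, y))"
  have t\<Omega>: "(?t, \<mu> (s, y)) \<in> \<Omega>" by (rule inv_\<Omega>(1)[OF sy])
  have sin: "s \<in> cimage c" using s by (simp add: \<Omega>_iff)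
  have "((\<lambda>z. \<mu> (?t, \<mu> (s, z))) has_derivative
      (\<lambda>u. d\<mu> (?t, \<mu> (s, y)) (0, d\<mu> (s, y) (0, u)))) (at y)"
    by (rule has_derivative_compose_Pair[OF \<mu>_has_derivative[OF t\<Omega>] has_derivative_const
          \<mu>_left_has_derivative[OF s]])
  moreover have "\<forall>\<^sub>F z in nhds y. \<mu> (?t, \<mu> (s, z)) = \<mu> (\<iota> y, z)"
    using near_left[OF s]
  proof eventually_elim
    case (elim z)
    then have z: "z \<in> cimage c" by (simp add: \<Omega>_iff)
    have "pt ?t \<otimes> pt (\<mu> (s, z)) = inv (pt s \<otimes> pt y) \<otimes> (pt s \<otimes> pt z)"
      by (simp add: pt_\<iota>[OF sy] pt_\<mu>[OF s] pt_\<mu>[OF elim])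
    also have "\<dots> = inv (pt y) \<otimes> (inv (pt s) \<otimes> (pt s \<otimes> pt z))"
      using pt_carrier[OF sin] pt_S[OF y] pt_carrier[OF z] by (simp add: inv_mult_group m_assoc)
    also have "\<dots> = inv (pt y) \<otimes> pt z"
      using pt_carrier[OF sin] pt_S[OF y] pt_carrier[OF z] by (simp add: m_assoc[symmetric])
    finally show ?case by (simp add: \<mu>_eq[of ?t] \<mu>_eq[of "\<iota> y"] pt_\<iota>[OF y])
  qed
  ultimately have "((\<lambda>z. \<mu> (\<iota> y, z)) has_derivative
      (\<lambda>u. d\<mu> (?t, \<mu> (s, y)) (0, d\<mu> (s, y) (0, u)))) (at y)"
    by (rule has_derivative_transform_nhds)
  from fun_cong[OF has_derivative_unique[OF this \<mu>_left_has_derivative[OF inv_\<Omega>(1)[OF y]]], of u]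
  show ?thesis by (simp add: theta_def)
qed

text \<open>Translation by the inverse \<open>s\<close> of \<open>x\<close> moves \<open>x\<close>
  to the unit and preserves \<open>theta\<close>. Differentiating this invariance at
  \<open>x\<close> gives the derivative of \<open>theta\<close> at the unit plus a second derivative
  \<open>H\<close> of the translation, which is symmetric and cancels.\<close>

lemma maurer_cartan:
  assumes x: "x \<in> S"
  shows "dtheta x u v - dtheta x v u = - br (theta x u) (theta x v)"
proof -
  define s where "s = \<iota> x"
  have s: "(s, x) \<in> \<Omega>" "\<mu> (s, x) = e"
    unfolding s_def using inv_\<Omega>(1)[OF x] \<mu>_inv(1)[OF x] by auto
  define H where "H u v = dir_deriv (\<lambda>z. d\<mu> z (0, v)) (s, x) (0, u)" for u v
  have "dtheta x u v = dtheta e (theta x u) (theta x v) + H u v" for u v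
  proof -
    have d1: "((\<lambda>y. d\<mu> (s, y) (0, v)) has_derivative (\<lambda>u. H u v)) (at x)"
      unfolding H_def
      by (rule has_derivative_compose_Pair[OF d\<mu>_has_derivative[OF s(1)] has_derivative_const
            has_derivative_ident])
    have d2: "((\<lambda>y. theta (\<mu> (s, y)) w) has_derivative (\<lambda>u. dtheta e (theta x u) w)) (at x)" for w
      using diff_chain_at[OF \<mu>_left_has_derivative[OF s(1)], of "\<lambda>z. theta z w" "\<lambda>u. dtheta e u w"]
        theta_has_derivative[OF e_S]
      by (simp add: s(2) o_def theta_def[of x] s_def[symmetric])
    obtain U where U: "open U" "x \<in> U" "\<And>y. y \<in> U \<Longrightarrow> (s, y) \<in> \<Omega> \<and> \<mu> (s, y) \<in> S \<and> y \<in> S"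
    proof -
      have "\<forall>\<^sub>F y in nhds x. (s, y) \<in> \<Omega> \<and> \<mu> (s, y) \<in> S \<and> y \<in> S"
        using near_left[OF s(1)] near_\<mu>[OF s(1) open_S] e_S s(2)
          eventually_nhds_in_open[where f = "\<lambda>y. y", OF continuous_ident open_S x]
        by (intro eventually_conj) simp_all
      then show ?thesis using that unfolding eventually_nhds by blast
    qed
    have "((\<lambda>y. theta (\<mu> (s, y)) (d\<mu> (s, y) (0, v))) has_derivative
        (\<lambda>u. dtheta e (theta x u) (d\<mu> (s, x) (0, v)) + theta (\<mu> (s, x)) (H u v))) (at x)"
      by (rule has_derivative_apply[OF U(1,2) _ d2 d1]) (use theta_linear U(3) in blast)
    then have "((\<lambda>y. theta y v) has_derivative
        (\<lambda>u. dtheta e (theta x u) (d\<mu> (s, x) (0, v)) + theta (\<mu> (s, x)) (H u v))) (at x)"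
      by (rule has_derivative_transform_within_open[OF _ U(1,2)])
        (use theta_left_invariant U(3) in blast)
    from dir_deriv_apply[OF this, of u]
    show ?thesis by (simp add: s(2) theta_e theta_def[of x] s_def[symmetric])
  qed
  moreover have "H u v = H v u"
    unfolding H_def by (rule d\<mu>_symmetric[OF s(1)])
  ultimately show ?thesis by (simp add: br_def)
qed

lemma dtheta_linear1: "x \<in> S \<Longrightarrow> linear (\<lambda>u. dtheta x u v)"
  using has_derivative_linear[OF theta_has_derivative] .

lemma dtheta_linear2:
  assumes x: "x \<in> S" shows "linear (\<lambda>v. dtheta x u v)"
proof (rule linearI)
  fix v w r
  have "((\<lambda>z. theta z (v + w)) has_derivative (\<lambda>u. dtheta x u v + dtheta x u w)) (at x)"
    by (rule has_derivative_transform_within_open[OF has_derivative_add[OF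
          theta_has_derivative[OF x] theta_has_derivative[OF x]] open_S x])
      (simp add: linear_add[OF theta_linear])
  then show "dtheta x u (v + w) = dtheta x u v + dtheta x u w" by (rule dir_deriv_apply)
  have "((\<lambda>z. theta z (r *\<^sub>R v)) has_derivative (\<lambda>u. r *\<^sub>R dtheta x u v)) (at x)"
    by (rule has_derivative_transform_within_open[OF has_derivative_scaleR_right[OF
          theta_has_derivative[OF x]] open_S x])
      (simp add: linear_scale[OF theta_linear])
  then show "dtheta x u (r *\<^sub>R v) = r *\<^sub>R dtheta x u v" by (rule dir_deriv_apply)
qed

lemma br_bilinear: "bilinear br"
  unfolding bilinear_def br_def
  by (intro conjI allI linear_compose_sub dtheta_linear1 dtheta_linear2 e_S)

lemma br_antisym: "br u v = - br v u" by (simp add: br_def)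

section \<open>From group commutators to the lower central filtration of the Lie algebra\<close>

text \<open>The derivative at the unit of the commutator map \<open>q \<mapsto> p\<inverse> q p q\<inverse>\<close>, where \<open>p\<close> has the
  coordinates \<open>x\<close>.\<close>

definition dcomm :: "'e \<Rightarrow> 'e \<Rightarrow> 'e" where
  "dcomm x v = theta x (d\<mu> (e, x) (v, 0)) - v"

text \<open>The commutator is formed by three products which, for \<open>y\<close> near
  \<open>e\<close>, all stay in the chart. The first two contribute the \<open>theta\<close> term of
  \<open>dcomm\<close>, and the factor \<open>inv (pt y)\<close> contributes the term
  \<open>- v\<close>.\<close>

lemma comm_has_derivative:
  assumes x: "x \<in> S"
  defines "C \<equiv> \<lambda>y. inv (pt x) \<otimes> pt y \<otimes> pt x \<otimes> inv (pt y)"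
  shows "((\<lambda>y. snd c (C y)) has_derivative dcomm x) (at e)"
    and "\<forall>\<^sub>F y in nhds e. C y \<in> fst c"
    and "snd c (C e) = e"
proof -
  define s where "s = \<iota> x"
  note xc = S_cimage[OF x]
  have \<Omega>: "(e, x) \<in> \<Omega>" "(s, x) \<in> \<Omega>" "(e, e) \<in> \<Omega>"
    unfolding s_def using right_\<Omega>[OF xc] inv_\<Omega>(1)[OF x] left_\<Omega>[OF e_in] by auto
  have \<mu>: "\<mu> (e, x) = x" "\<mu> (s, x) = e"
    unfolding s_def using \<mu>_unit(2)[OF xc] \<mu>_inv(1)[OF x] by auto
  have d1: "((\<lambda>y. \<mu> (y, x)) has_derivative (\<lambda>u. d\<mu> (e, x) (u, 0))) (at e)"
    by (rule has_derivative_compose_Pair[OF \<mu>_has_derivative[OF \<Omega>(1)] has_derivative_ident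
          has_derivative_const])
  have d2: "((\<lambda>y. \<mu> (s, \<mu> (y, x))) has_derivative (\<lambda>u. theta x (d\<mu> (e, x) (u, 0)))) (at e)"
    using has_derivative_compose_Pair[where F = \<mu> and F' = "d\<mu> (s, x)", OF _ has_derivative_const d1]
      \<mu>_has_derivative[OF \<Omega>(2)]
    by (simp add: \<mu> theta_def s_def[symmetric])
  define R where "R y = \<mu> (\<mu> (s, \<mu> (y, x)), \<iota> y)" for y
  have "(R has_derivative
      (\<lambda>u. d\<mu> (e, e) (theta x (d\<mu> (e, x) (u, 0)), dir_deriv \<iota> e u))) (at e)"
    unfolding R_def
    using has_derivative_compose_Pair[where F = \<mu> and F' = "d\<mu> (e, e)", OF _ d2 \<iota>_has_derivative[OF e_S]]
      \<mu>_has_derivative[OF \<Omega>(3)]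
    by (simp add: \<mu> \<iota>_e)
  moreover have "d\<mu> (e, e) (w, dir_deriv \<iota> e u) = w - u" for w u
    using d\<mu>_split[OF \<Omega>(3), of w "- u"] by (simp add: d\<iota>_e d\<mu>_unit[OF e_in])
  ultimately have R: "(R has_derivative dcomm x) (at e)"
    by (simp add: dcomm_def[abs_def])
  have n1: "\<forall>\<^sub>F y in nhds e. (y, x) \<in> \<Omega>"
    by (rule eventually_nhds_in_open[where f = "\<lambda>y. (y, x)", OF _ open_\<Omega> \<Omega>(1)])
      (intro continuous_intros)
  have n2: "\<forall>\<^sub>F y in nhds e. (s, \<mu> (y, x)) \<in> \<Omega>"
    by (rule eventually_nhds_in_open[where f = "\<lambda>y. (s, \<mu> (y, x))", OF _ open_\<Omega>])
      (intro continuous_intros has_derivative_continuous[OF d1], simp add: \<mu> \<Omega>)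
  have n3: "\<forall>\<^sub>F y in nhds e. (\<mu> (s, \<mu> (y, x)), \<iota> y) \<in> \<Omega>"
    by (rule eventually_nhds_in_open[where f = "\<lambda>y. (\<mu> (s, \<mu> (y, x)), \<iota> y)", OF _ open_\<Omega>])
      (intro continuous_intros has_derivative_continuous[OF d2]
        has_derivative_continuous[OF \<iota>_has_derivative[OF e_S]], simp add: \<mu> \<iota>_e \<Omega>)
  have n4: "\<forall>\<^sub>F y in nhds e. y \<in> S"
    by (rule eventually_nhds_in_open[where f = "\<lambda>y. y", OF continuous_ident open_S e_S])
  have eq: "R y = snd c (C y) \<and> C y \<in> fst c"
    if "(y, x) \<in> \<Omega>" "(s, \<mu> (y, x)) \<in> \<Omega>" "(\<mu> (s, \<mu> (y, x)), \<iota> y) \<in> \<Omega>" "y \<in> S" for y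
  proof -
    have "pt (\<mu> (s, \<mu> (y, x))) = inv (pt x) \<otimes> pt y \<otimes> pt x"
      unfolding pt_\<mu>[OF that(2)] pt_\<mu>[OF that(1)] unfolding s_def pt_\<iota>[OF x]
      using pt_S[OF x] pt_S[OF that(4)] by (simp add: m_assoc)
    then show ?thesis
      using that(3) by (simp add: R_def \<mu>_eq[of "\<mu> (s, \<mu> (y, x))"] \<Omega>_iff pt_\<iota>[OF that(4)] C_def)
  qed
  have near: "\<forall>\<^sub>F y in nhds e. R y = snd c (C y) \<and> C y \<in> fst c"
    using n1 n2 n3 n4 by eventually_elim (rule eq)
  show "((\<lambda>y. snd c (C y)) has_derivative dcomm x) (at e)"
    by (rule has_derivative_transform_nhds[OF R])
      (rule eventually_mono[OF near conjunct1])
  show "\<forall>\<^sub>F y in nhds e. C y \<in> fst c"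
    by (rule eventually_mono[OF near conjunct2])
  show "snd c (C e) = e"
    using pt_S[OF x] by (simp add: C_def pt_e)
qed

text \<open>Nilpotency of the group passes to the Lie algebra through the derivatives at the unit of the
  iterated commutators, as functions of their last argument; no exponential map is needed.\<close>

definition central_map :: "nat \<Rightarrow> ('e \<Rightarrow> 'e) \<Rightarrow> bool" where
  "central_map j D \<longleftrightarrow> (\<exists>f. f e = e \<and> (f has_derivative D) (at e) \<and>
    (\<forall>\<^sub>F y in nhds e. f y \<in> cimage c \<and> pt (f y) \<in> lower_central G j))"

definition central_space :: "nat \<Rightarrow> 'e set" where
  "central_space j = span {D v | D v. central_map j D}"

lemma central_map_0: "central_map 0 (\<lambda>v. v)"
  unfolding central_map_def
proof (intro exI[of _ "\<lambda>y. y"] conjI has_derivative_ident refl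
    eventually_mono[OF near_cimage[OF e_in]])
  fix x assume "x \<in> cimage c"
  then show "pt x \<in> lower_central G 0"
    unfolding lower_central.simps by (rule pt_carrier)
qed

lemma central_map_Suc:
  assumes "central_map j D" and x: "x \<in> S"
  shows "central_map (Suc j) (\<lambda>v. dcomm x (D v))"
proof -
  obtain f where f: "f e = e" "(f has_derivative D) (at e)"
    "\<forall>\<^sub>F y in nhds e. f y \<in> cimage c \<and> pt (f y) \<in> lower_central G j"
    using assms(1) by (auto simp: central_map_def)
  define C where "C y = inv (pt x) \<otimes> pt y \<otimes> pt x \<otimes> inv (pt y)" for y
  note C = comm_has_derivative[OF x, folded C_def]
  have "((\<lambda>y. snd c (C (f y))) has_derivative (\<lambda>v. dcomm x (D v))) (at e)"
    using diff_chain_at[OF f(2), of "\<lambda>y. snd c (C y)" "dcomm x"] C(1) by (simp add: f(1) o_def)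
  moreover have "\<forall>\<^sub>F y in nhds e. C (f y) \<in> fst c"
  proof -
    obtain U where U: "open U" "e \<in> U" "\<And>y. y \<in> U \<Longrightarrow> C y \<in> fst c"
      using C(2) unfolding eventually_nhds by blast
    have "\<forall>\<^sub>F y in nhds e. f y \<in> U"
      by (rule eventually_nhds_in_open[OF has_derivative_continuous[OF f(2)] U(1)])
        (simp add: f(1) U(2))
    then show ?thesis by eventually_elim (rule U(3))
  qed
  then have "\<forall>\<^sub>F y in nhds e. snd c (C (f y)) \<in> cimage c \<and>
      pt (snd c (C (f y))) \<in> lower_central G (Suc j)"
    using f(3)
  proof eventually_elim
    case (elim y)
    \<comment> \<open>The shape required by \<open>lower_central\<close>, with
      \<open>inv (pt x)\<close> as the first entry of the commutator.\<close>
    have "C (f y) = inv (pt x) \<otimes> pt (f y) \<otimes> inv (inv (pt x)) \<otimes> inv (pt (f y))"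
      using pt_S[OF x] by (simp add: C_def)
    moreover have "inv (pt x) \<in> carrier G" "pt (f y) \<in> lower_central G j"
      using elim(2) pt_S[OF x] by simp_all
    ultimately have "C (f y) \<in> lower_central G (Suc j)"
      unfolding lower_central.simps by (intro generate.incl) blast
    then show ?case using elim(1) by (simp add: pt_snd)
  qed
  ultimately show ?thesis
    unfolding central_map_def
    by (intro exI[of _ "\<lambda>y. snd c (C (f y))"]) (simp add: f(1) C(3))
qed

text \<open>A map with values in the trivial subgroup is constant near \<open>e\<close>.\<close>

lemma central_map_trivial:
  assumes "central_map n D" "lower_central G n = {\<one>}"
  shows "D v = 0"
proof -
  obtain f where f: "(f has_derivative D) (at e)"
    "\<forall>\<^sub>F y in nhds e. f y \<in> cimage c \<and> pt (f y) \<in> lower_central G n"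
    using assms(1) by (auto simp: central_map_def)
  have "\<forall>\<^sub>F y in nhds e. f y = e"
    using f(2)
  proof eventually_elim
    case (elim y)
    then show ?case using snd_pt[of "f y"] assms(2) by simp
  qed
  from has_derivative_unique[OF has_derivative_transform_nhds[OF f(1) this] has_derivative_const]
  show ?thesis by simp
qed

text \<open>To second order the group commutator is the bracket; the minus sign comes from
  \<open>inv (pt x)\<close> standing first. Everything reduces to the mixed second derivatives
  \<open>H\<close> of \<mu> at \<open>(e, e)\<close>.\<close>

lemma dcomm_has_derivative:
  "((\<lambda>x. dcomm x v) has_derivative (\<lambda>u. - br u v)) (at e)"
proof -
  define H where "H w z = dir_deriv (\<lambda>y. d\<mu> y w) (e, e) z" for w z
  note ee = left_\<Omega>[OF e_in]
  have Hsym: "H w z = H z w" for w z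
    unfolding H_def by (rule d\<mu>_symmetric[OF ee])
  have K: "((\<lambda>x. d\<mu> (e, x) (v, 0)) has_derivative (\<lambda>u. H (v, 0) (0, u))) (at e)" for v
    unfolding H_def
    by (rule has_derivative_compose_Pair[OF d\<mu>_has_derivative[OF ee] has_derivative_const
          has_derivative_ident])
  have frame': "((\<lambda>x. frame x v) has_derivative (\<lambda>u. H (0, v) (u, 0))) (at e)" for v
    unfolding H_def frame_def
    by (rule has_derivative_compose_Pair[OF d\<mu>_has_derivative[OF ee] has_derivative_ident
          has_derivative_const])
  have frame_e: "frame e v = v" for v
    by (simp add: frame_def d\<mu>_unit[OF e_in])
  have "((\<lambda>x. theta x (frame x v)) has_derivative
      (\<lambda>u. dtheta e u (frame e v) + theta e (H (0, v) (u, 0)))) (at e)" for v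
    by (rule has_derivative_apply[OF open_S e_S theta_linear theta_has_derivative[OF e_S] frame'])
  then have "((\<lambda>x. v) has_derivative (\<lambda>u. dtheta e u v + H (0, v) (u, 0))) (at e)" for v
    unfolding frame_e theta_e
    by (rule has_derivative_transform_within_open[OF _ open_S e_S]) (rule theta_frame)
  \<comment> \<open>Differentiating the constant \<open>theta x (frame x v)\<close> at the unit
    expresses \<open>dtheta e\<close> through \<open>H\<close>.\<close>
  from fun_cong[OF has_derivative_unique[OF this has_derivative_const]]
  have dtheta_e: "dtheta e u v = - H (0, v) (u, 0)" for u v
    by (simp add: eq_neg_iff_add_eq_0)
  have "((\<lambda>x. theta x (d\<mu> (e, x) (v, 0)) - v) has_derivative
      (\<lambda>u. dtheta e u (d\<mu> (e, e) (v, 0)) + theta e (H (v, 0) (0, u)) - 0)) (at e)"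
    by (intro has_derivative_diff has_derivative_const has_derivative_apply[OF open_S e_S
          theta_linear theta_has_derivative[OF e_S] K])
  moreover have "dtheta e u (d\<mu> (e, e) (v, 0)) + theta e (H (v, 0) (0, u)) - 0 = - br u v" for u
    unfolding br_def d\<mu>_unit[OF e_in] theta_e dtheta_e Hsym[of "(v, 0)"] by simp
  ultimately show ?thesis by (simp add: dcomm_def[abs_def])
qed

lemma dcomm_linear: "x \<in> S \<Longrightarrow> linear (dcomm x)"
  using has_derivative_linear[OF comm_has_derivative(1)] .

lemma dcomm_e: "dcomm e v = 0"
  by (simp add: dcomm_def theta_e d\<mu>_unit[OF e_in])

lemma dcomm_central_space:
  assumes "v \<in> central_space j" and x: "x \<in> S"
  shows "dcomm x v \<in> central_space (Suc j)"
proof -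
  have "{D v | D v. central_map j D} \<subseteq> dcomm x -` central_space (Suc j)"
  proof
    fix w assume "w \<in> {D v | D v. central_map j D}"
    then obtain D u where D: "w = D u" "central_map j D" by blast
    have "dcomm x (D u) \<in> central_space (Suc j)"
      unfolding central_space_def
      by (rule span_base, rule CollectI, rule exI[of _ "\<lambda>v. dcomm x (D v)"], rule exI[of _ u])
        (simp add: central_map_Suc[OF D(2) x])
    then show "w \<in> dcomm x -` central_space (Suc j)" using D(1) by simp
  qed
  moreover have "subspace (dcomm x -` central_space (Suc j))"
    by (intro linear_subspace_vimage[OF dcomm_linear[OF x]])
      (simp add: central_space_def)
  ultimately have "central_space j \<subseteq> dcomm x -` central_space (Suc j)"
    unfolding central_space_def[of j] by (rule span_minimal)
  then show ?thesis using assms by auto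
qed

text \<open>For fixed \<open>v\<close> all the vectors \<open>dcomm x v\<close> lie in one subspace,
  hence so does their derivative in \<open>x\<close> at the unit, which is minus the
  bracket.\<close>

lemma br_central_space:
  assumes v: "v \<in> central_space j" shows "br u v \<in> central_space (Suc j)"
proof -
  have sub: "subspace (central_space (Suc j))" by (simp add: central_space_def)
  have "- br u v \<in> central_space (Suc j)"
    by (rule derivative_in_subspace[OF open_S e_S sub _ dcomm_has_derivative])
      (simp add: dcomm_e dcomm_central_space[OF v])
  then show ?thesis using subspace_neg[OF sub] by fastforce
qed

lemma central_space_0: "central_space 0 = UNIV"
proof -
  have "v \<in> central_space 0" for v
    unfolding central_space_def
    by (rule span_base, rule CollectI, rule exI[of _ "\<lambda>v. v"], rule exI[of _ v])
      (simp add: central_map_0)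
  then show ?thesis by auto
qed

lemma central_space_trivial:
  assumes "lower_central G n = {\<one>}" shows "central_space n = {0}"
proof -
  have "{D v | D v. central_map n D} \<subseteq> {0}"
    using central_map_trivial[OF _ assms] by auto
  from span_mono[OF this] show ?thesis
    by (auto simp: central_space_def span_zero)
qed

section \<open>Invariant metrics and fields, and transport of brackets to the unit\<close>

lemma differential_left_translation:
  assumes x: "x \<in> S"
  shows "differential c c (\<lambda>y. inv (pt x) \<otimes> y) (pt x) u = theta x u"
proof -
  have "snd c \<circ> (\<lambda>y. inv (pt x) \<otimes> y) \<circ> cinv c = (\<lambda>y. \<mu> (\<iota> x, y))"
    by (auto simp: \<mu>_eq pt_\<iota>[OF x])
  then show ?thesis
    using dir_deriv_apply[OF \<mu>_left_has_derivative[OF inv_\<Omega>(1)[OF x]]]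
    by (simp add: differential_def snd_pt[OF S_cimage[OF x]] theta_def)
qed

lemma metric_eq_theta:
  assumes "left_invariant_metric G A g" and x: "x \<in> S"
  shows "g c (pt x) u v = g c \<one> (theta x u) (theta x v)"
proof -
  have p: "pt x \<in> fst c" "inv (pt x) \<in> carrier G" "inv (pt x) \<otimes> pt x = \<one>"
    using pt_in[OF S_cimage[OF x]] pt_S[OF x] by auto
  then have "g c (inv (pt x) \<otimes> pt x)
      (differential c c (\<lambda>y. inv (pt x) \<otimes> y) (pt x) u)
      (differential c c (\<lambda>y. inv (pt x) \<otimes> y) (pt x) v) = g c (pt x) u v"
    using assms(1) c one_in unfolding left_invariant_metric_def by metis
  then show ?thesis by (simp add: p differential_left_translation[OF x])
qed

lemma left_invariant_field_theta:
  assumes "left_invariant_field G A V" and x: "x \<in> S"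
  shows "theta x (V c (pt x)) = V c \<one>"
proof -
  have p: "pt x \<in> fst c" "inv (pt x) \<in> carrier G" "inv (pt x) \<otimes> pt x = \<one>"
    using pt_in[OF S_cimage[OF x]] pt_S[OF x] by auto
  then have "V c (inv (pt x) \<otimes> pt x)
      = differential c c (\<lambda>y. inv (pt x) \<otimes> y) (pt x) (V c (pt x))"
    using assms(1) c one_in unfolding left_invariant_field_def by metis
  then show ?thesis by (simp add: p differential_left_translation[OF x])
qed

lemma field_has_derivative:
  assumes "left_invariant_field G A V" "d \<in> A" "x \<in> cimage d"
  shows "((V d \<circ> cinv d) has_derivative dir_deriv (V d \<circ> cinv d) x) (at x)"
proof -
  have "Ck_on (Suc 0) (V d \<circ> cinv d) (cimage d)"
    using assms by (simp only: left_invariant_field_def smooth_vector_field_def smooth_on_def)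
  from Ck_on_Suc_D(1)[OF this assms(3)] show ?thesis .
qed

text \<open>On a left invariant field \<open>theta\<close> is constant, so the derivative of the
  field at the unit is minus that of \<open>theta\<close>.\<close>

lemma lie_bracket_unit:
  assumes V: "left_invariant_field G A V" and V': "left_invariant_field G A V'"
  shows "lie_bracket V V' c \<one> = br (V c \<one>) (V' c \<one>)"
proof -
  have d: "dir_deriv (W c \<circ> pt) e u = - dtheta e u (W c \<one>)"
    if W: "left_invariant_field G A W" for W u
  proof -
    have "((\<lambda>x. theta x ((W c \<circ> pt) x)) has_derivative
        (\<lambda>u. dtheta e u ((W c \<circ> pt) e) + theta e (dir_deriv (W c \<circ> pt) e u))) (at e)"
      by (rule has_derivative_apply[OF open_S e_S theta_linear theta_has_derivative[OF e_S]
            field_has_derivative[OF W c e_in]])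
    then have "((\<lambda>x. W c \<one>) has_derivative
        (\<lambda>u. dtheta e u ((W c \<circ> pt) e) + theta e (dir_deriv (W c \<circ> pt) e u))) (at e)"
      by (rule has_derivative_transform_within_open[OF _ open_S e_S])
        (simp add: left_invariant_field_theta[OF W])
    from fun_cong[OF has_derivative_unique[OF this has_derivative_const], of u]
    show ?thesis by (simp add: theta_e pt_e eq_neg_iff_add_eq_0 add.commute)
  qed
  show ?thesis
    unfolding lie_bracket_def d[OF V] d[OF V'] by (simp add: br_def)
qed

text \<open>The element \<open>a\<close> may lie outside the unit chart, so the multiplication is
  read with a chart \<open>d'\<close> around \<open>a\<close> and its first argument is frozen
  there.\<close>

lemma left_translation_smooth:
  assumes d: "d \<in> A" and a: "a \<in> carrier G"
  shows "open {y \<in> cimage d. a \<otimes> cinv d y \<in> fst c}"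
    and "Ck_on k (snd c \<circ> (\<lambda>q. a \<otimes> q) \<circ> cinv d) {y \<in> cimage d. a \<otimes> cinv d y \<in> fst c}"
proof -
  obtain d' where d': "d' \<in> A" "a \<in> fst d'"
    using a charts_cover topspace_eq by blast
  define z where "z = snd d' a"
  have z: "z \<in> cimage d'" "cinv d' z = a"
    using d' cinv_chart by (auto simp: z_def)
  have eq: "{y \<in> cimage d. a \<otimes> cinv d y \<in> fst c} = (\<lambda>y. (z, y)) -` mul_dom d' d c"
    using z by (auto simp: mul_dom_def)
  show op: "open {y \<in> cimage d. a \<otimes> cinv d y \<in> fst c}"
    unfolding eq by (rule open_vimage[OF open_mul_dom[OF d'(1) d c]]) (intro continuous_intros)
  have "Ck_on k (\<lambda>y. mul d' d c (z, y)) {y \<in> cimage d. a \<otimes> cinv d y \<in> fst c}"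
    by (rule Ck_on_compose[OF op Ck_on_mul[OF d'(1) d c] Ck_on_Pair[OF op Ck_on_const[OF op]
          Ck_on_bounded_linear[OF op bounded_linear_ident]]])
      (use eq in auto)
  moreover have "(\<lambda>y. mul d' d c (z, y)) = snd c \<circ> (\<lambda>q. a \<otimes> q) \<circ> cinv d"
    by (auto simp: mul_def z)
  ultimately show "Ck_on k (snd c \<circ> (\<lambda>q. a \<otimes> q) \<circ> cinv d) {y \<in> cimage d. a \<otimes> cinv d y \<in> fst c}"
    by simp
qed

text \<open>Related fields have related brackets: left invariance makes each field related to itself
  under the translation \<open>M\<close>, and the second derivative of \<open>M\<close> drops out by
  symmetry.\<close>

lemma lie_bracket_transport:
  assumes V: "left_invariant_field G A V" and V': "left_invariant_field G A V'"
    and d: "d \<in> A" and p: "p \<in> fst d"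
  shows "differential d c (\<lambda>q. inv p \<otimes> q) p (lie_bracket V V' d p) = lie_bracket V V' c \<one>"
proof -
  define a where "a = inv p"
  have pG: "p \<in> carrier G" by (rule chart_carrier[OF d p])
  then have a: "a \<in> carrier G" "a \<otimes> p = \<one>" by (simp_all add: a_def)
  define M where "M = snd c \<circ> (\<lambda>q. a \<otimes> q) \<circ> cinv d"
  define U where "U = {y \<in> cimage d. a \<otimes> cinv d y \<in> fst c}"
  have U: "open U" "Ck_on k M U" for k
    unfolding U_def M_def by (rule left_translation_smooth[OF d a(1)])+
  define x where "x = snd d p"
  have cx: "cinv d x = p" by (simp add: x_def cinv_chart[OF d p])
  have xU: "x \<in> U" using p one_in by (simp add: U_def cx a(2)) (simp add: x_def)
  have xd: "x \<in> cimage d" using xU by (simp add: U_def)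
  have Mx: "M x = e" by (simp add: M_def cx a(2))
  note dM = Ck_on_Suc_D(1)[OF U(2)]
  define H where "H u w = dir_deriv (\<lambda>z. dir_deriv M z w) x u" for u w
  have Hsym: "H u w = H w u" for u w
    unfolding H_def by (rule Ck_on_symmetric[OF U(1) xU U(2)])
  have related: "(W c \<circ> pt) (M y) = dir_deriv M y ((W d \<circ> cinv d) y)"
    if W: "left_invariant_field G A W" and y: "y \<in> U" for W y
  proof -
    have q: "cinv d y \<in> fst d" "a \<otimes> cinv d y \<in> fst c" "snd d (cinv d y) = y"
      using y chart_cinv[of y d] by (auto simp: U_def)
    have "W c (a \<otimes> cinv d y) = differential d c (\<lambda>q. a \<otimes> q) (cinv d y) (W d (cinv d y))"
      using W q d c a(1) unfolding left_invariant_field_def by blast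
    then show ?thesis
      by (simp add: differential_def M_def q pt_snd)
  qed
  have chain: "dir_deriv (W c \<circ> pt) e (dir_deriv M x u)
      = H u (W d p) + dir_deriv M x (dir_deriv (W d \<circ> cinv d) x u)"
    if W: "left_invariant_field G A W" for W u
  proof -
    have 1: "((\<lambda>y. (W c \<circ> pt) (M y)) has_derivative
        (\<lambda>u. dir_deriv (W c \<circ> pt) e (dir_deriv M x u))) (at x)"
      using diff_chain_at[OF dM[OF xU], of "W c \<circ> pt" "dir_deriv (W c \<circ> pt) e"]
        field_has_derivative[OF W c e_in] by (simp add: Mx o_def)
    have "((\<lambda>y. dir_deriv M y ((W d \<circ> cinv d) y)) has_derivative
        (\<lambda>u. H u ((W d \<circ> cinv d) x) + dir_deriv M x (dir_deriv (W d \<circ> cinv d) x u))) (at x)"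
      unfolding H_def
      by (rule has_derivative_apply[OF U(1) xU has_derivative_linear[OF dM]
            Ck_on_Suc_D(1)[OF Ck_on_Suc_D(2)[OF U(2)] xU] field_has_derivative[OF W d xd]])
    then have 2: "((\<lambda>y. (W c \<circ> pt) (M y)) has_derivative
        (\<lambda>u. H u ((W d \<circ> cinv d) x) + dir_deriv M x (dir_deriv (W d \<circ> cinv d) x u))) (at x)"
      by (rule has_derivative_transform_within_open[OF _ U(1) xU]) (simp only: related[OF W])
    from fun_cong[OF has_derivative_unique[OF 1 2], of u]
    show ?thesis by (simp add: cx)
  qed
  have at_x: "dir_deriv M x (W d p) = W c \<one>" if W: "left_invariant_field G A W" for W
    using related[OF W xU] by (simp add: Mx cx pt_e)
  have "dir_deriv M x (lie_bracket V V' d p)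
      = dir_deriv M x (dir_deriv (V' d \<circ> cinv d) x (V d p))
        - dir_deriv M x (dir_deriv (V d \<circ> cinv d) x (V' d p))"
    unfolding lie_bracket_def x_def[symmetric]
    by (rule linear_diff[OF has_derivative_linear[OF dM[OF xU]]])
  also have "\<dots> = dir_deriv (V' c \<circ> pt) e (dir_deriv M x (V d p))
        - dir_deriv (V c \<circ> pt) e (dir_deriv M x (V' d p))"
    unfolding chain[OF V] chain[OF V'] Hsym[of "V d p"] by simp
  also have "\<dots> = lie_bracket V V' c \<one>"
    by (simp add: at_x[OF V] at_x[OF V'] lie_bracket_def)
  finally show ?thesis
    by (simp add: differential_def M_def x_def a_def)
qed

text \<open>Translation to the unit sends a bracket to a value of \<open>br\<close>, which is zero.
  It also preserves lengths in the invariant metric, so the bracket itself has length zero.\<close>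

lemma abelian_lie_algebraI:
  assumes metric: "riemannian_metric A g" and inv_metric: "left_invariant_metric G A g"
    and br: "\<And>u v. br u v = 0"
  shows "abelian_lie_algebra G A"
  unfolding abelian_lie_algebra_def
proof (intro allI impI ballI)
  fix V V' d p
  assume V: "left_invariant_field G A V" "left_invariant_field G A V'"
    and d: "d \<in> A" and p: "p \<in> fst d"
  define w where "w = lie_bracket V V' d p"
  have pG: "p \<in> carrier G" by (rule chart_carrier[OF d p])
  have "differential d c (\<lambda>q. inv p \<otimes> q) p w = 0"
    unfolding w_def by (simp add: lie_bracket_transport[OF V d p] lie_bracket_unit[OF V] br)
  moreover have "g c (inv p \<otimes> p) (differential d c (\<lambda>q. inv p \<otimes> q) p w)
      (differential d c (\<lambda>q. inv p \<otimes> q) p w) = g d p w w"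
  proof -
    have "inv p \<in> carrier G" "inv p \<otimes> p \<in> fst c" using pG one_in by simp_all
    from inv_metric[unfolded left_invariant_metric_def, rule_format, OF this(1) d c p this(2)]
    show ?thesis .
  qed
  ultimately have "g d p w w = g c \<one> 0 0" using pG by simp
  moreover have "bilinear (g c \<one>)" using metric c one_in by (simp add: riemannian_metric_def)
  ultimately have "g d p w w = 0" by (simp add: bilinear_lzero)
  then show "lie_bracket V V' d p = 0"
    using metric d p unfolding w_def riemannian_metric_def by (metis less_irrefl)
qed

section \<open>Gradient solitons on nilpotent groups\<close>

text \<open>An isometry \<open>L\<close> from the inner product at the unit to the standard one
  turns \<open>br\<close>, \<open>theta\<close> and \<open>central_space\<close> into the metric Lie
  algebra, coframe and filtration of the preceding parts, where a nonzero bracket is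
  contradictory.\<close>

lemma gradient_soliton_br_zero:
  assumes metric: "riemannian_metric A g" and inv_metric: "left_invariant_metric G A g"
    and nilpotent: "lower_central G n = {\<one>}"
    and f: "smooth_function A f"
    and soliton: "\<And>p u v. p \<in> fst c \<Longrightarrow> ricci g c p u v + hessian g f c p u v = l * g c p u v"
  shows "br u v = 0"
proof (rule ccontr)
  assume nonzero: "br u v \<noteq> 0"
  have B: "bilinear (g c \<one>)" "\<And>u v. g c \<one> u v = g c \<one> v u" "\<And>u. u \<noteq> 0 \<Longrightarrow> g c \<one> u u > 0"
    using metric c one_in by (auto simp: riemannian_metric_def)
  have "\<exists>L :: 'e \<Rightarrow> 'e. linear L \<and> inj L \<and> (\<forall>u v. g c \<one> u v = L u \<bullet> L v)"
    by (rule posdef_form_factor) (use B in auto)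
  then obtain L :: "'e \<Rightarrow> 'e" where L: "linear L" "inj L" "\<And>u v. g c \<one> u v = L u \<bullet> L v"
    by blast
  obtain K where K: "linear K" "\<And>u. K (L u) = u" "\<And>u. L (K u) = u"
    using linear_injective_isomorphism[OF L(1,2)] by blast
  define br' where "br' u v = L (br (K u) (K v))" for u v
  have bl: "bounded_linear L" using L(1) by (simp add: linear_conv_bounded_linear)
  have lie: "metric_lie_algebra br'"
  proof
    have lin: "linear (br u)" "linear (\<lambda>u. br u v)" for u v
      using br_bilinear by (auto simp: bilinear_def)
    show "bilinear br'"
      unfolding bilinear_def br'_def
      using linear_compose[OF linear_compose[OF K(1) lin(1)] L(1)]
        linear_compose[OF linear_compose[OF K(1) lin(2)] L(1)]
      by (simp add: o_def)
    show "br' u v = - br' v u" for u v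
      using br_antisym[of "K u" "K v"] by (simp add: br'_def linear_neg[OF L(1)])
  qed
  interpret C: left_invariant_coframe br' S "\<lambda>x u. L (theta x u)" "\<lambda>x v. frame x (K v)"
  proof (intro left_invariant_coframe.intro[OF lie] left_invariant_coframe_axioms.intro)
    show "open S" by (rule open_S)
    show "linear (\<lambda>u. L (theta x u))" if "x \<in> S" for x
      using linear_compose[OF theta_linear[OF that] L(1)] by (simp add: o_def)
    show "Ck_on 2 (\<lambda>z. L (theta z w)) S" for w
      by (rule Ck_on_linear_compose[OF open_S bl Ck_on_theta])
    show "L (theta x (frame x (K v))) = v" if "x \<in> S" for x v
      by (simp add: theta_frame[OF that] K)
    show "(\<lambda>z. frame z (K v)) differentiable at x" if "x \<in> S" for x v
      using Ck_on_Suc_D(1)[OF Ck_on_frame that] by (rule differentiableI)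
    show "dir_deriv (\<lambda>z. L (theta z v)) x u - dir_deriv (\<lambda>z. L (theta z u)) x v
        = - br' (L (theta x u)) (L (theta x v))" if "x \<in> S" for x u v
    proof -
      have "dir_deriv (\<lambda>z. L (theta z v)) x u = L (dtheta x u v)" for u v
        by (rule dir_deriv_apply[OF bounded_linear.has_derivative[OF bl
                theta_has_derivative[OF that]]])
      then show ?thesis
        by (simp add: br'_def K linear_diff[OF L(1), symmetric] maurer_cartan[OF that]
            linear_neg[OF L(1)])
    qed
  qed
  have Ric: "\<exists>t\<ge>0. C.Ric w w = l * t" if "C.nab w w = 0" for w
  proof (rule C.Ric_geodesic_coframe[where h = "local_metric g c" and \<phi> = "f \<circ> pt", OF _ _ _ e_S that])
    show "g c (pt x) u v = L (theta x u) \<bullet> L (theta x v)" if "x \<in> S" for x u v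
      by (simp add: metric_eq_theta[OF inv_metric that] L(3))
    have "Ck_on 2 (f \<circ> pt) (cimage c)"
      using f c by (simp add: smooth_function_def smooth_on_def)
    then show "Ck_on 2 (f \<circ> pt) S" by (rule Ck_on_subset) (use S_cimage in blast)
    show "ricci_coord (local_metric g c) x u v + hessian_coord (local_metric g c) (f \<circ> pt) x u v
        = l * g c (pt x) u v" if "x \<in> S" for x u v
      using soliton[OF pt_in[OF S_cimage[OF that]], of u v]
      by (simp add: ricci_def hessian_def snd_pt[OF S_cimage[OF that]])
  qed
  have sub: "subspace (L ` central_space j)" for j
    by (rule linear_subspace_image[OF L(1)]) (simp add: central_space_def)
  have zero: "L ` central_space 0 = UNIV"
    unfolding central_space_0 using K(3) by (rule surjI)
  have step: "br' w z \<in> L ` central_space (Suc j)" if "z \<in> L ` central_space j" for w z j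
    using that br_central_space by (auto simp: br'_def K)
  have trivial: "L ` central_space n = {0}"
    by (simp add: central_space_trivial[OF nilpotent] linear_0[OF L(1)])
  have nonabelian: "br' (L u) (L v) \<noteq> 0"
    using nonzero linear_0[OF L(1)] injD[OF L(2), of "br u v" 0] by (auto simp: br'_def K)
  show False
    by (rule nilpotent_metric_lie_algebra_Ric_filtration[OF lie,
          where E = "\<lambda>j. L ` central_space j"])
      (fact sub zero step trivial nonabelian Ric)+
qed

end

theorem theorem0p2:
  fixes N :: "('a, 'm) monoid_scheme"
    and T :: "'a topology"
    and A :: "('a, 'e::euclidean_space) chart set"
    and g :: "('a, 'e) tensor2"
  assumes "lie_group N T A"
    and "nilpotent_group N"
    and "\<not> abelian_lie_algebra N A"
    and "riemannian_metric A g"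
    and "left_invariant_metric N A g"
    and "ricci_soliton A g"
  shows "\<not> (\<exists>(f :: 'a \<Rightarrow> real) (l :: real). smooth_function A f \<and>
           (\<forall>c\<in>A. \<forall>p \<in> fst c. \<forall>u v.
              ricci g c p u v + hessian g f c p u v = l * g c p u v))"
proof
  assume "\<exists>f l. smooth_function A f \<and>
      (\<forall>c\<in>A. \<forall>p \<in> fst c. \<forall>u v. ricci g c p u v + hessian g f c p u v = l * g c p u v)"
  then obtain f l where f: "smooth_function A f"
    and soliton: "\<And>c p u v. c \<in> A \<Longrightarrow> p \<in> fst c \<Longrightarrow>
      ricci g c p u v + hessian g f c p u v = l * g c p u v"
    by blast
  interpret lie_group N T A by fact
  obtain c where c: "c \<in> A" "\<one>\<^bsub>N\<^esub> \<in> fst c"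
    using charts_cover topspace_eq one_closed by blast
  interpret lie_group_unit_chart N T A c
    by unfold_locales (rule c)+
  obtain n where "lower_central N n = {\<one>\<^bsub>N\<^esub>}"
    using assms(2) by (auto simp: nilpotent_group_def)
  then have "br u v = 0" for u v
    using gradient_soliton_br_zero[OF assms(4,5) _ f soliton[OF c(1)]] by blast
  then show False
    using abelian_lie_algebraI[OF assms(4,5)] assms(3) by blast
qed

end
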